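(* Let $U\subseteq\mathcal V$ be a finite nonempty node set and let $\mathbb D_U\subseteq\mathbb R^{n_U}$ be a convex set such that (a) $\boldsymbol Q_U\succeq 0$, and (b) for every $\boldsymbol d_U\in\mathbb D_U$ the problem $P_U(\boldsymbol d_U)$ has a primal-dual solution at which the second-order sufficient condition (SOSC) and the linear independence constraint qualification (LICQ) hold. Then for all $\boldsymbol d_U=\{d_j\}_{j\in U}$ and $\boldsymbol d_U'=\{d_j'\}_{j\in U}$ in $\mathbb D_U$ and every $i\in U$, $$\left\Vert T_{i\leftarrow U}\left(\boldsymbol z_U^*(\boldsymbol d_U)-\boldsymbol z_U^*(\boldsymbol d_U')\right)\right\Vert\le\sum_{j\in U}\Gamma_U\,\rho_U^{\left\lceil\frac{\Delta_U(i,j)-1}{2}\right\rceil}\Vert d_j-d_j'\Vert,$$ where $\Gamma_U:=\overline\sigma_U/\underline\sigma_U^2$, $\rho_U:=(\overline\sigma_U^2-\underline\sigma_U^2)/(\overline\sigma_U^2+\underline\sigma_U^2)$, $\underline\sigma_U:=\min_{B\in\mathbb B_U}\sigma_{\min}(\boldsymbol H_U[B,B])$ and $\overline\sigma_U:=\max_{B\in\mathbb B_U}\sigma_{\max}(\boldsymbol H_U[B,B])$.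
   Context: Graph and data. $\mathcal G(\mathcal V,\mathcal E)$ is an undirected, possibly infinite graph with totally ordered (integer-labelled) node set $\mathcal V$. For $X\subseteq U\subseteq\mathcal V$, $N_U(X):=\{j\in U\setminus X:\exists i\in X,\ \{i,j\}\in\mathcal E\}$ and $N_U[X]:=N_U(X)\cup X$; a single node is treated as a singleton. For each node $i$ there are integers $r_i\ge1$, $m_i^{\mathcal E},m_i^{\mathcal I}\ge0$, $m_i:=m_i^{\mathcal E}+m_i^{\mathcal I}$, $n_i:=r_i+m_i$. The fixed data are real matrices $Q_{i,j}\in\mathbb R^{r_i\times r_j}$ with $Q_{i,j}=Q_{j,i}^\top$, $A^{\mathcal E}_{i,j}\in\mathbb R^{m^{\mathcal E}_i\times r_j}$, $A^{\mathcal I}_{i,j}\in\mathbb R^{m^{\mathcal I}_i\times r_j}$, all equal to zero if $i\ne j$ and $\{i,j\}\notin\mathcal E$. $A_{i,j}$ is $A^{\mathcal E}_{i,j}$ stacked over $A^{\mathcal I}_{i,j}$, and $H_{i,j}:=\begin{bmatrix}Q_{i,j}&A_{j,i}^\top\\ A_{i,j}&0\end{bmatrix}\in\mathbb R^{n_i\times n_j}$. Problem. For a finite nonempty $U\subseteq\mathcal V$ put $n_U:=\sum_{i\in U}n_i$, and let $\boldsymbol Q_U,\boldsymbol A_U,\boldsymbol A_U^{\mathcal E},\boldsymbol A_U^{\mathcal I},\boldsymbol H_U$ be the block matrices with blocks $Q_{i,j},A_{i,j},A_{i,j}^{\mathcal E},A_{i,j}^{\mathcal I},H_{i,j}$, $i,j\in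 U$ (nodes in increasing order). Write $\boldsymbol z_U=\{z_i\}_{i\in U}$ with $z_i=(x_i,\lambda_i)$, $\lambda_i=(\lambda_i^{\mathcal E},\lambda_i^{\mathcal I})$, and $\boldsymbol d_U=\{d_i\}_{i\in U}$ with $d_i=(f_i,g_i)$, $g_i=(g_i^{\mathcal E},g_i^{\mathcal I})$, so $\boldsymbol z_U,\boldsymbol d_U\in\mathbb R^{n_U}$; $\boldsymbol x_U,\boldsymbol\lambda_U,\boldsymbol f_U$, etc. collect the corresponding parts over $i\in U$. The quadratic program $P_U(\boldsymbol d_U)$ is: minimize $\frac12\boldsymbol x_U^\top\boldsymbol Q_U\boldsymbol x_U-\boldsymbol f_U^\top\boldsymbol x_U$ over $\boldsymbol x_U$ subject to $\boldsymbol A^{\mathcal E}_U\boldsymbol x_U=\boldsymbol g^{\mathcal E}_U$ (multiplier $\boldsymbol\lambda_U^{\mathcal E}$) and $\boldsymbol A^{\mathcal I}_U\boldsymbol x_U\ge\boldsymbol g^{\mathcal I}_U$ (multiplier $\boldsymbol\lambda_U^{\mathcal I}$). A primal-dual solution is a vector $\boldsymbol z_U$ satisfying the KKT conditions $\boldsymbol Q_U\boldsymbol x_U+\boldsymbol A_U^\top\boldsymbol\lambda_U=\boldsymbol f_U$, $\boldsymbol A_U^{\mathcal E}\boldsymbol x_U=\boldsymbol g_U^{\mathcal E}$, $\boldsymbol A_U^{\mathcal I}\boldsymbol x_U\ge\boldsymbol g_U^{\mathcal I}$, $\boldsymbol\lambda_U^{\mathcal I}\le0$, $\mathrm{diag}(\boldsymbol\lambda_U^{\mathcal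 I})(\boldsymbol A_U^{\mathcal I}\boldsymbol x_U-\boldsymbol g_U^{\mathcal I})=0$. LICQ: the rows of $\boldsymbol A_U$ of the active constraints (all equalities, and inequalities holding with equality) are linearly independent. SOSC: $w^\top\boldsymbol Q_Uw>0$ for every nonzero $w$ in the critical cone at the primal-dual solution. Under (a) and (b), for each $\boldsymbol d_U\in\mathbb D_U$ the primal-dual solution is unique; it is denoted $\boldsymbol z_U^*(\boldsymbol d_U)$. Bases. $M[B,B]$ and $v[B]$ denote the submatrix/subvector with indices in $B$. A nonempty $B\subseteq\{1,\dots,n_U\}$ is a basis if $\boldsymbol H_U[B,B]$ is nonsingular. Its basic solution for $P_U(\boldsymbol d_U)$ is the vector $\boldsymbol z_U^B(\boldsymbol d_U)\in\mathbb R^{n_U}$ with $\boldsymbol H_U[B,B]\,\boldsymbol z_U^B(\boldsymbol d_U)[B]=\boldsymbol d_U[B]$ and all components outside $B$ zero. $B$ is optimal for $P_U(\boldsymbol d_U)$ if it is a basis and its basic solution is a primal-dual solution of $P_U(\boldsymbol d_U)$. $\mathbb B_U$ is the set of all $B$ that are optimal for $P_U(\boldsymbol d_U)$ for some $\boldsymbol d_U\in\mathbb D_U$. Other notation. $T_{i\leftarrow U}$ extracts from $\boldsymbol z_U$ the block $z_i\in\mathbb R^{n_i}$. $\Delta_U(i,j)$ is the graph distance between $i$ and $j$ in the subgraph of $\mathcal G$ induced by $U$ ($+\infty$ if not connected, with $\rho^{\infty}:=0$; also $0^0:=1$). $\Vert\cdot\Vert$ is the Euclidean norm; $\sigma_{\min},\sigma_{\max}$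 are the smallest and largest singular values. *)

theory Defs
  imports
    Complex_Main
    "HOL-Library.Extended_Nat"
    "Jordan_Normal_Form.Matrix"
    "Jordan_Normal_Form.VS_Connect"
    "Jordan_Normal_Form.Char_Poly"
    "Jordan_Normal_Form.DL_Submatrix"
begin

text \<open>All indices into vectors and matrices are 0-based, so an index set
  \<open>B \<subseteq> {1,\<dots>,n}\<close> becomes \<open>B \<subseteq> {..<n}\<close>.\<close>

section \<open>Real vectors and matrices\<close>

definition euclid_norm :: "real vec \<Rightarrow> real" where
  "euclid_norm v = sqrt (v \<bullet> v)"

definition convex_vecs :: "real vec set \<Rightarrow> bool" where
  "convex_vecs D \<longleftrightarrow>
     (\<forall>x\<in>D. \<forall>y\<in>D. \<forall>t. 0 \<le> t \<and> t \<le> 1 \<longrightarrow> (1 - t) \<cdot>\<^sub>v x + t \<cdot>\<^sub>v y \<in> D)"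

definition pos_semidef :: "real mat \<Rightarrow> bool" where
  "pos_semidef M \<longleftrightarrow> square_mat M \<and> M\<^sup>T = M \<and>
     (\<forall>w \<in> carrier_vec (dim_row M). 0 \<le> w \<bullet> (M *\<^sub>v w))"

text \<open>The set below is the set of singular values when \<open>M\<close> has at least as many rows as
  columns; it is only used for square \<open>M\<close>.\<close>

definition singular_values :: "real mat \<Rightarrow> real set" where
  "singular_values M = {sqrt e | e. eigenvalue (M\<^sup>T * M) e}"

definition sigma_min :: "real mat \<Rightarrow> real" where
  "sigma_min M = Min (singular_values M)"

definition sigma_max :: "real mat \<Rightarrow> real" where
  "sigma_max M = Max (singular_values M)"

text \<open>\<open>v[B]\<close>, with the entries taken in the same order as in \<^const>\<open>submatrix\<close>.\<close>

definition subvec :: "'a vec \<Rightarrow> nat set \<Rightarrow> 'a vec" where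
  "subvec v B = vec (card {k. k < dim_vec v \<and> k \<in> B}) (\<lambda>k. v $ pick B k)"

text \<open>The rows with index in \<open>K\<close> are independent as a family: \<^const>\<open>inj_on\<close> excludes
  repeated rows, which the library's notion for sets of vectors cannot see.\<close>

definition lin_indpt_rows :: "real mat \<Rightarrow> nat set \<Rightarrow> bool" where
  "lin_indpt_rows M K \<longleftrightarrow> inj_on (row M) K \<and>
     \<not> module.lin_dep class_ring (module_vec TYPE(real) (dim_col M)) (row M ` K)"

section \<open>Stacking node blocks in increasing node order\<close>

text \<open>Node \<open>i \<in> U\<close> contributes \<open>s i\<close> consecutive entries, starting at \<open>block_start U s i\<close>.
  Conversely, the flat index \<open>p\<close> is entry \<open>block_pos U s p\<close> of node \<open>block_node U s p\<close>.\<close>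

definition block_total :: "int set \<Rightarrow> (int \<Rightarrow> nat) \<Rightarrow> nat" where
  "block_total U s = (\<Sum>i\<in>U. s i)"

definition block_start :: "int set \<Rightarrow> (int \<Rightarrow> nat) \<Rightarrow> int \<Rightarrow> nat" where
  "block_start U s i = (\<Sum>j | j \<in> U \<and> j < i. s j)"

definition block_node :: "int set \<Rightarrow> (int \<Rightarrow> nat) \<Rightarrow> nat \<Rightarrow> int" where
  "block_node U s p =
     (THE i. i \<in> U \<and> block_start U s i \<le> p \<and> p < block_start U s i + s i)"

definition block_pos :: "int set \<Rightarrow> (int \<Rightarrow> nat) \<Rightarrow> nat \<Rightarrow> nat" where
  "block_pos U s p = p - block_start U s (block_node U s p)"

definition block_vec :: "int set \<Rightarrow> (int \<Rightarrow> nat) \<Rightarrow> (int \<Rightarrow> real vec) \<Rightarrow> real vec" where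
  "block_vec U s v = vec (block_total U s) (\<lambda>p. v (block_node U s p) $ block_pos U s p)"

definition block_mat ::
  "int set \<Rightarrow> (int \<Rightarrow> nat) \<Rightarrow> (int \<Rightarrow> nat) \<Rightarrow> (int \<Rightarrow> int \<Rightarrow> real mat) \<Rightarrow> real mat" where
  "block_mat U s t M = mat (block_total U s) (block_total U t)
     (\<lambda>(p, q). M (block_node U s p) (block_node U t q) $$ (block_pos U s p, block_pos U t q))"

definition extract_block :: "int set \<Rightarrow> (int \<Rightarrow> nat) \<Rightarrow> int \<Rightarrow> real vec \<Rightarrow> real vec" where
  "extract_block U s i v = vec (s i) (\<lambda>k. v $ (block_start U s i + k))"

section \<open>Graph-structured quadratic programs\<close>

record graph_qp =
  nodes :: "int set"
  edges :: "int set set"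
  rdim :: "int \<Rightarrow> nat"
  mEdim :: "int \<Rightarrow> nat"
  mIdim :: "int \<Rightarrow> nat"
  Qblk :: "int \<Rightarrow> int \<Rightarrow> real mat"
  AEblk :: "int \<Rightarrow> int \<Rightarrow> real mat"
  AIblk :: "int \<Rightarrow> int \<Rightarrow> real mat"

definition mdim :: "graph_qp \<Rightarrow> int \<Rightarrow> nat" where
  "mdim G i = mEdim G i + mIdim G i"

definition ndim :: "graph_qp \<Rightarrow> int \<Rightarrow> nat" where
  "ndim G i = rdim G i + mdim G i"

definition valid_graph_qp :: "graph_qp \<Rightarrow> bool" where
  "valid_graph_qp G \<longleftrightarrow>
     (\<forall>e\<in>edges G. \<exists>i\<in>nodes G. \<exists>j\<in>nodes G. e = {i, j}) \<and>
     (\<forall>i\<in>nodes G. 1 \<le> rdim G i) \<and>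
     (\<forall>i\<in>nodes G. \<forall>j\<in>nodes G.
        Qblk G i j \<in> carrier_mat (rdim G i) (rdim G j) \<and>
        AEblk G i j \<in> carrier_mat (mEdim G i) (rdim G j) \<and>
        AIblk G i j \<in> carrier_mat (mIdim G i) (rdim G j) \<and>
        Qblk G i j = (Qblk G j i)\<^sup>T \<and>
        (i \<noteq> j \<and> {i, j} \<notin> edges G \<longrightarrow>
           Qblk G i j = 0\<^sub>m (rdim G i) (rdim G j) \<and>
           AEblk G i j = 0\<^sub>m (mEdim G i) (rdim G j) \<and>
           AIblk G i j = 0\<^sub>m (mIdim G i) (rdim G j)))"

definition Ablk :: "graph_qp \<Rightarrow> int \<Rightarrow> int \<Rightarrow> real mat" where
  "Ablk G i j = AEblk G i j @\<^sub>r AIblk G i j"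

definition Hblk :: "graph_qp \<Rightarrow> int \<Rightarrow> int \<Rightarrow> real mat" where
  "Hblk G i j =
     four_block_mat (Qblk G i j) ((Ablk G j i)\<^sup>T) (Ablk G i j) (0\<^sub>m (mdim G i) (mdim G j))"

definition Qmat :: "graph_qp \<Rightarrow> int set \<Rightarrow> real mat" where
  "Qmat G U = block_mat U (rdim G) (rdim G) (Qblk G)"

definition Amat :: "graph_qp \<Rightarrow> int set \<Rightarrow> real mat" where
  "Amat G U = block_mat U (mdim G) (rdim G) (Ablk G)"

definition AEmat :: "graph_qp \<Rightarrow> int set \<Rightarrow> real mat" where
  "AEmat G U = block_mat U (mEdim G) (rdim G) (AEblk G)"

definition AImat :: "graph_qp \<Rightarrow> int set \<Rightarrow> real mat" where
  "AImat G U = block_mat U (mIdim G) (rdim G) (AIblk G)"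

definition Hmat :: "graph_qp \<Rightarrow> int set \<Rightarrow> real mat" where
  "Hmat G U = block_mat U (ndim G) (ndim G) (Hblk G)"

abbreviation nU :: "graph_qp \<Rightarrow> int set \<Rightarrow> nat" where
  "nU G U \<equiv> block_total U (ndim G)"

text \<open>The operator \<open>T\<^bsub>i\<leftarrow>U\<^esub>\<close>.\<close>

definition Tblk :: "graph_qp \<Rightarrow> int set \<Rightarrow> int \<Rightarrow> real vec \<Rightarrow> real vec" where
  "Tblk G U i z = extract_block U (ndim G) i z"

text \<open>Each node block is \<open>z\<^sub>i = (x\<^sub>i, \<lambda>\<^sub>i\<^sup>E, \<lambda>\<^sub>i\<^sup>I)\<close> or \<open>d\<^sub>i = (f\<^sub>i, g\<^sub>i\<^sup>E, g\<^sub>i\<^sup>I)\<close>. The parts below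
  give \<open>x\<close>, \<open>\<lambda>\<close>, \<open>\<lambda>\<^sup>E\<close>, \<open>\<lambda>\<^sup>I\<close> of \<open>z\<close> and likewise \<open>f\<close>, \<open>g\<close>, \<open>g\<^sup>E\<close>, \<open>g\<^sup>I\<close> of \<open>d\<close>.\<close>

definition x_part :: "graph_qp \<Rightarrow> int set \<Rightarrow> real vec \<Rightarrow> real vec" where
  "x_part G U z = block_vec U (rdim G) (\<lambda>i. vec_first (Tblk G U i z) (rdim G i))"

definition l_part :: "graph_qp \<Rightarrow> int set \<Rightarrow> real vec \<Rightarrow> real vec" where
  "l_part G U z = block_vec U (mdim G) (\<lambda>i. vec_last (Tblk G U i z) (mdim G i))"

definition lE_part :: "graph_qp \<Rightarrow> int set \<Rightarrow> real vec \<Rightarrow> real vec" where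
  "lE_part G U z = block_vec U (mEdim G)
     (\<lambda>i. vec_first (vec_last (Tblk G U i z) (mdim G i)) (mEdim G i))"

definition lI_part :: "graph_qp \<Rightarrow> int set \<Rightarrow> real vec \<Rightarrow> real vec" where
  "lI_part G U z = block_vec U (mIdim G)
     (\<lambda>i. vec_last (vec_last (Tblk G U i z) (mdim G i)) (mIdim G i))"

section \<open>KKT conditions, LICQ and SOSC\<close>

definition primal_dual_solution :: "graph_qp \<Rightarrow> int set \<Rightarrow> real vec \<Rightarrow> real vec \<Rightarrow> bool" where
  "primal_dual_solution G U d z \<longleftrightarrow> z \<in> carrier_vec (nU G U) \<and>
     Qmat G U *\<^sub>v x_part G U z + (Amat G U)\<^sup>T *\<^sub>v l_part G U z = x_part G U d \<and>
     AEmat G U *\<^sub>v x_part G U z = lE_part G U d \<and>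
     lI_part G U d \<le> AImat G U *\<^sub>v x_part G U z \<and>
     lI_part G U z \<le> 0\<^sub>v (block_total U (mIdim G)) \<and>
     mat_diag (block_total U (mIdim G)) (($) (lI_part G U z)) *\<^sub>v
       (AImat G U *\<^sub>v x_part G U z - lI_part G U d) = 0\<^sub>v (block_total U (mIdim G))"

text \<open>Row \<open>p\<close> of \<^const>\<open>Amat\<close> belongs to an equality constraint iff its position inside its
  node block is below \<^const>\<open>mEdim\<close>.\<close>

definition active_rows :: "graph_qp \<Rightarrow> int set \<Rightarrow> real vec \<Rightarrow> real vec \<Rightarrow> nat set" where
  "active_rows G U d z = {p. p < block_total U (mdim G) \<and>
     (block_pos U (mdim G) p < mEdim G (block_node U (mdim G) p) \<or>
      (Amat G U *\<^sub>v x_part G U z) $ p = l_part G U d $ p)}"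

definition LICQ :: "graph_qp \<Rightarrow> int set \<Rightarrow> real vec \<Rightarrow> real vec \<Rightarrow> bool" where
  "LICQ G U d z \<longleftrightarrow> lin_indpt_rows (Amat G U) (active_rows G U d z)"

definition critical_cone :: "graph_qp \<Rightarrow> int set \<Rightarrow> real vec \<Rightarrow> real vec \<Rightarrow> real vec set" where
  "critical_cone G U d z = {w \<in> carrier_vec (block_total U (rdim G)).
     AEmat G U *\<^sub>v w = 0\<^sub>v (block_total U (mEdim G)) \<and>
     (\<forall>k < block_total U (mIdim G).
        (AImat G U *\<^sub>v x_part G U z) $ k = lI_part G U d $ k \<longrightarrow>
          (if lI_part G U z $ k < 0 then (AImat G U *\<^sub>v w) $ k = 0
           else 0 \<le> (AImat G U *\<^sub>v w) $ k))}"

definition SOSC :: "graph_qp \<Rightarrow> int set \<Rightarrow> real vec \<Rightarrow> real vec \<Rightarrow> bool" where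
  "SOSC G U d z \<longleftrightarrow> (\<forall>w \<in> critical_cone G U d z.
     w \<noteq> 0\<^sub>v (block_total U (rdim G)) \<longrightarrow> 0 < w \<bullet> (Qmat G U *\<^sub>v w))"

text \<open>Meaningful where the primal-dual solution is unique.\<close>

definition zstar :: "graph_qp \<Rightarrow> int set \<Rightarrow> real vec \<Rightarrow> real vec" where
  "zstar G U d = (THE z. primal_dual_solution G U d z)"

section \<open>Bases\<close>

definition is_basis :: "graph_qp \<Rightarrow> int set \<Rightarrow> nat set \<Rightarrow> bool" where
  "is_basis G U B \<longleftrightarrow>
     B \<noteq> {} \<and> B \<subseteq> {..<nU G U} \<and> invertible_mat (submatrix (Hmat G U) B B)"

definition basic_solution :: "graph_qp \<Rightarrow> int set \<Rightarrow> nat set \<Rightarrow> real vec \<Rightarrow> real vec" where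
  "basic_solution G U B d = (THE z. z \<in> carrier_vec (nU G U) \<and>
     submatrix (Hmat G U) B B *\<^sub>v subvec z B = subvec d B \<and>
     (\<forall>p < nU G U. p \<notin> B \<longrightarrow> z $ p = 0))"

definition optimal_basis :: "graph_qp \<Rightarrow> int set \<Rightarrow> real vec \<Rightarrow> nat set \<Rightarrow> bool" where
  "optimal_basis G U d B \<longleftrightarrow>
     is_basis G U B \<and> primal_dual_solution G U d (basic_solution G U B d)"

definition optimal_bases :: "graph_qp \<Rightarrow> int set \<Rightarrow> real vec set \<Rightarrow> nat set set" where
  "optimal_bases G U D = {B. \<exists>d\<in>D. optimal_basis G U d B}"

section \<open>Constants and graph distance in the bound\<close>

definition sigma_lower :: "graph_qp \<Rightarrow> int set \<Rightarrow> real vec set \<Rightarrow> real" where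
  "sigma_lower G U D = Min ((\<lambda>B. sigma_min (submatrix (Hmat G U) B B)) ` optimal_bases G U D)"

definition sigma_upper :: "graph_qp \<Rightarrow> int set \<Rightarrow> real vec set \<Rightarrow> real" where
  "sigma_upper G U D = Max ((\<lambda>B. sigma_max (submatrix (Hmat G U) B B)) ` optimal_bases G U D)"

definition Gamma_const :: "graph_qp \<Rightarrow> int set \<Rightarrow> real vec set \<Rightarrow> real" where
  "Gamma_const G U D = sigma_upper G U D / (sigma_lower G U D)\<^sup>2"

definition rho_const :: "graph_qp \<Rightarrow> int set \<Rightarrow> real vec set \<Rightarrow> real" where
  "rho_const G U D =
     ((sigma_upper G U D)\<^sup>2 - (sigma_lower G U D)\<^sup>2) /
     ((sigma_upper G U D)\<^sup>2 + (sigma_lower G U D)\<^sup>2)"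

definition induced_adj :: "graph_qp \<Rightarrow> int set \<Rightarrow> (int \<times> int) set" where
  "induced_adj G U = {(i, j). i \<in> U \<and> j \<in> U \<and> {i, j} \<in> edges G}"

text \<open>The least length of a walk inside \<open>U\<close>; the infimum over the empty set is \<open>\<infinity>\<close>.\<close>

definition graph_dist :: "graph_qp \<Rightarrow> int set \<Rightarrow> int \<Rightarrow> int \<Rightarrow> enat" where
  "graph_dist G U i j = (INF k \<in> {k. (i, j) \<in> induced_adj G U ^^ k}. enat k)"

text \<open>\<open>\<rho>\<close> to the power \<open>\<lceil>(\<Delta> - 1) / 2\<rceil>\<close>. For \<open>\<Delta> = 0\<close> the exponent is
  \<open>\<lceil>-1/2\<rceil> = 0\<close>, so \<^const>\<open>nat\<close> never truncates; the natural-number power has \<open>0\<^sup>0 = 1\<close>.\<close>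

definition dist_decay :: "real \<Rightarrow> enat \<Rightarrow> real" where
  "dist_decay \<rho> \<Delta> =
     (case \<Delta> of enat k \<Rightarrow> \<rho> ^ nat \<lceil>(real k - 1) / 2\<rceil> | \<infinity> \<Rightarrow> 0)"

end

theory Submission
  imports Defs "HOL-Analysis.L2_Norm" "HOL-Analysis.Elementary_Metric_Spaces"
begin

text \<open>
  Restrict the data to the segment from \<open>d\<close> to \<open>d'\<close>. At every point of it LICQ and SOSC make the
  primal variables together with the active constraints an optimal basis, whose basic solution is
  the unique primal-dual solution. The parameters at which a given basis is optimal form a closed
  set, and there are finitely many bases, so \<open>z\<^sup>*\<close> is piecewise affine along the segment and it
  suffices to bound the change while one basis \<open>B\<close> stays optimal.

  There the change of \<open>z\<^sup>*[B]\<close> is \<open>K e\<close>, where \<open>K\<close> is the inverse of \<open>H = H\<^sub>U[B,B]\<close> and \<open>e\<close> is the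
  change of the data. Put \<open>c = 2 / (a + b)\<close> and \<open>M = I - c H\<^sup>2\<close> with \<open>a\<close>, \<open>b\<close> the squares of
  \<open>sigma_lower\<close>, \<open>sigma_upper\<close>; then \<open>M\<close> has norm at most \<open>\<rho> = (b - a) / (b + a)\<close> and
  \<open>K = c H (I + M + \<dots> + M\<^sup>k\<^sup>-\<^sup>1) + M\<^sup>k K\<close>. The first summand reaches only nodes at distance at most
  \<open>2 k - 1\<close>, so farther blocks of \<open>K\<close> are blocks of \<open>M\<^sup>k K\<close>, of norm at most \<open>\<rho>\<^sup>k / sigma_lower\<close>.
\<close>

section \<open>Symmetric operators on functions with finite index set\<close>

text \<open>The KKT matrix is in general indefinite, so \<open>I - c H\<close> need not contract for
  any \<open>c\<close>, whereas \<open>H^2\<close> is positive definite; the price is that every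
  step of the iteration travels two edges. The factor \<open>c\<close> is the reciprocal of the
  midpoint of \<open>a\<close> and \<open>b\<close>, which places the quadratic form of
  \<open>c H^2\<close> between \<open>1 - \<rho>\<close> and \<open>1 + \<rho>\<close>. Dropping the
  first summand requires \<open>2 k - 1 < \<Delta>\<close>, and the largest such \<open>k\<close> is
  the ceiling of \<open>(\<Delta> - 1) / 2\<close>; this is where the exponent comes from. The
  prefactor obtained is \<open>1 / sigma_lower\<close>, which is at most
  \<open>sigma_upper / sigma_lower^2\<close>. Several bases can be optimal for the same data, so
  breakpoints along the segment are not canonical; the gluing rests on finiteness, closedness and
  the triangle inequality. Vectors are treated as functions and index sets as summation ranges, so
  that passing to \<open>H[B,B]\<close> or to a node block changes only the range of a sum and
  re-enumerates nothing.\<close>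

definition ip :: "'a set \<Rightarrow> ('a \<Rightarrow> real) \<Rightarrow> ('a \<Rightarrow> real) \<Rightarrow> real" where
  "ip B u v = (\<Sum>p\<in>B. u p * v p)"

text \<open>The set restricts the columns only, and the row \<open>p\<close> is arbitrary. With one
  matrix \<open>H\<close>, the choice of column set and row yields \<open>Q x\<close>,
  \<open>A x\<close> and the transposed product.\<close>

definition mv :: "'a set \<Rightarrow> ('a \<Rightarrow> 'a \<Rightarrow> real) \<Rightarrow> ('a \<Rightarrow> real) \<Rightarrow> 'a \<Rightarrow> real" where
  "mv B H v p = (\<Sum>q\<in>B. H p q * v q)"

definition linear_op :: "'a set \<Rightarrow> (('a \<Rightarrow> real) \<Rightarrow> 'a \<Rightarrow> real) \<Rightarrow> bool" where
  "linear_op B T \<longleftrightarrow> (\<forall>u c v. \<forall>p\<in>B. T (\<lambda>q. u q + c * v q) p = T u p + c * T v p)"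

definition sym_op :: "'a set \<Rightarrow> (('a \<Rightarrow> real) \<Rightarrow> 'a \<Rightarrow> real) \<Rightarrow> bool" where
  "sym_op B T \<longleftrightarrow> linear_op B T \<and> (\<forall>u v. ip B u (T v) = ip B (T u) v)"

lemma ip_cong: "(\<And>p. p \<in> B \<Longrightarrow> u p = u' p) \<Longrightarrow> (\<And>p. p \<in> B \<Longrightarrow> v p = v' p) \<Longrightarrow> ip B u v = ip B u' v'"
  by (simp add: ip_def)

lemma ip_commute: "ip B u v = ip B v u"
  by (simp add: ip_def mult.commute)

lemma ip_nonneg: "0 \<le> ip B u u"
  by (simp add: ip_def sum_nonneg)

lemma ip_self_eq_0_iff: "finite B \<Longrightarrow> ip B u u = 0 \<longleftrightarrow> (\<forall>p\<in>B. u p = 0)"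
  by (simp add: ip_def sum_nonneg_eq_0_iff)

lemma ip_add_scaled_left: "ip B (\<lambda>p. u p + c * v p) w = ip B u w + c * ip B v w"
  by (simp add: ip_def sum.distrib sum_distrib_left algebra_simps)

lemma ip_add_scaled_right: "ip B w (\<lambda>p. u p + c * v p) = ip B w u + c * ip B w v"
  by (simp add: ip_def sum.distrib sum_distrib_left algebra_simps)

lemma L2_set_power2: "(L2_set v B)\<^sup>2 = ip B v v"
  by (simp add: L2_set_def ip_def sum_nonneg power2_eq_square)

lemma mv_add_scaled: "mv B H (\<lambda>q. u q + c * v q) p = mv B H u p + c * mv B H v p"
  by (simp add: mv_def sum.distrib sum_distrib_left algebra_simps)

lemma mv_cong: "(\<And>q. q \<in> B \<Longrightarrow> u q = v q) \<Longrightarrow> mv B H u p = mv B H v p"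
  by (simp add: mv_def)

lemma sym_op_mv:
  assumes "\<forall>p\<in>B. \<forall>q\<in>B. H p q = H q p"
  shows "sym_op B (mv B H)"
proof -
  have "ip B u (mv B H v) = ip B (mv B H u) v" for u v
  proof -
    have "ip B u (mv B H v) = (\<Sum>p\<in>B. \<Sum>q\<in>B. u p * H p q * v q)"
      by (simp add: ip_def mv_def sum_distrib_left mult.assoc)
    also have "\<dots> = (\<Sum>q\<in>B. \<Sum>p\<in>B. u p * H p q * v q)"
      by (rule sum.swap)
    also have "\<dots> = ip B (mv B H u) v"
      unfolding ip_def mv_def sum_distrib_right
      using assms by (intro sum.cong) (simp_all add: mult.commute)
    finally show ?thesis .
  qed
  then show ?thesis
    by (simp add: sym_op_def linear_op_def mv_add_scaled)
qed

lemma quadratic_form_add_scaled: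
  assumes "sym_op B T"
  shows "ip B (\<lambda>q. u q + c * w q) (T (\<lambda>q. u q + c * w q))
       = ip B u (T u) + 2 * c * ip B w (T u) + c\<^sup>2 * ip B w (T w)"
proof -
  have "ip B x (T (\<lambda>q. u q + c * w q)) = ip B x (\<lambda>q. T u q + c * T w q)" for x
    using assms by (intro ip_cong) (auto simp: sym_op_def linear_op_def)
  moreover have "ip B u (T w) = ip B w (T u)"
    using assms by (metis sym_op_def ip_commute)
  ultimately show ?thesis
    by (simp add: ip_add_scaled_left ip_add_scaled_right algebra_simps power2_eq_square)
qed

text \<open>For a symmetric operator the numerical radius controls the norm. This is what turns
  spectral bounds on \<open>H^2\<close> into a contraction estimate for \<open>M\<close>.\<close>

lemma norm_le_of_quadratic_form_le:
  assumes T: "sym_op B T" and r: "0 \<le> r"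
    and bnd: "\<And>v. \<bar>ip B v (T v)\<bar> \<le> r * ip B v v"
  shows "ip B (T v) (T v) \<le> r\<^sup>2 * ip B v v"
proof -
  let ?w = "T v"
  \<comment> \<open>polarization along \<open>v \<plusminus> t T v\<close>\<close>
  have key: "4 * t * ip B ?w ?w \<le> 2 * r * (ip B v v + t\<^sup>2 * ip B ?w ?w)" for t
  proof -
    have n: "ip B (\<lambda>q. v q + c * ?w q) (\<lambda>q. v q + c * ?w q)
        = ip B v v + 2 * c * ip B ?w v + c\<^sup>2 * ip B ?w ?w" for c
      by (simp add: ip_add_scaled_left ip_add_scaled_right ip_commute[of B v ?w]
          algebra_simps power2_eq_square)
    show ?thesis
      using abs_le_D1[OF bnd[of "\<lambda>q. v q + t * ?w q"]]
        abs_le_D2[OF bnd[of "\<lambda>q. v q + (-t) * ?w q"]]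
      unfolding quadratic_form_add_scaled[OF T] n
      by (simp add: algebra_simps)
  qed
  show ?thesis
  \<comment> \<open>The best choice \<open>t = 1/r\<close> needs \<open>r > 0\<close>; for
    \<open>r = 0\<close> every positive \<open>t\<close> forces \<open>T v = 0\<close> on
    \<open>B\<close> already.\<close>
  proof (cases "r = 0")
    case True
    then show ?thesis using key[of 1] by simp
  next
    case False
    with r have "r > 0" by simp
    with key[of "1/r"] show ?thesis by (simp add: field_simps power2_eq_square)
  qed
qed

text \<open>For a positive semidefinite operator a lower bound on the norm (\<open>K\<close>)
  improves to a lower bound on the quadratic form: nonnegativity of the form at
  \<open>v - T v / C\<close>, with the upper bound \<open>C\<close> applied at \<open>T v\<close>,
  gives \<open>|T v|^2 <= C <v, T v>\<close>.\<close>

lemma quadratic_form_coercive: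
  assumes T: "sym_op B T"
    and psd: "\<And>v. 0 \<le> ip B v (T v)"
    and C: "C > 0" "\<And>v. ip B v (T v) \<le> C * ip B v v"
    and K: "K > 0" "\<And>v. ip B v v \<le> K * ip B (T v) (T v)"
  shows "ip B v v \<le> C * K * ip B v (T v)"
proof -
  have "0 \<le> ip B v (T v) - 2 / C * ip B (T v) (T v) + (1 / C)\<^sup>2 * ip B (T v) (T (T v))"
    using psd[of "\<lambda>q. v q + (-1/C) * T v q"]
    unfolding quadratic_form_add_scaled[OF T] by simp
  also have "(1 / C)\<^sup>2 * ip B (T v) (T (T v)) \<le> (1 / C)\<^sup>2 * (C * ip B (T v) (T v))"
    by (intro mult_left_mono C) simp
  finally have "ip B (T v) (T v) \<le> C * ip B v (T v)"
    using C(1) by (simp add: field_simps power2_eq_square)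
  then have "K * ip B (T v) (T v) \<le> K * (C * ip B v (T v))"
    using K(1) by (intro mult_left_mono) auto
  with K(2)[of v] show ?thesis by (simp add: algebra_simps)
qed

lemma Cauchy_Schwarz_sum:
  fixes f g :: "'a \<Rightarrow> real"
  shows "(\<Sum>q\<in>B. f q * g q)\<^sup>2 \<le> (\<Sum>q\<in>B. (f q)\<^sup>2) * (\<Sum>q\<in>B. (g q)\<^sup>2)"
proof -
  have "\<bar>\<Sum>q\<in>B. f q * g q\<bar> \<le> (\<Sum>q\<in>B. \<bar>f q\<bar> * \<bar>g q\<bar>)"
    using sum_abs[of "\<lambda>q. f q * g q" B] by (simp add: abs_mult)
  also have "\<dots> \<le> L2_set f B * L2_set g B"
    by (rule L2_set_mult_ineq)
  finally have "(\<Sum>q\<in>B. f q * g q)\<^sup>2 \<le> (L2_set f B * L2_set g B)\<^sup>2"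
    by (rule abs_le_square_iff[THEN iffD1, OF order_trans]) simp
  then show ?thesis
    by (simp add: power_mult_distrib L2_set_def sum_nonneg)
qed

text \<open>The constant is the squared Frobenius norm; it serves only where some finite bound is
  wanted.\<close>

lemma mv_norm_le:
  assumes "finite B"
  shows "ip B (mv B H v) (mv B H v) \<le> (\<Sum>p\<in>B. \<Sum>q\<in>B. (H p q)\<^sup>2) * ip B v v"
proof -
  have "ip B (mv B H v) (mv B H v) = (\<Sum>p\<in>B. (\<Sum>q\<in>B. H p q * v q)\<^sup>2)"
    by (simp add: ip_def mv_def power2_eq_square)
  also have "\<dots> \<le> (\<Sum>p\<in>B. (\<Sum>q\<in>B. (H p q)\<^sup>2) * (\<Sum>q\<in>B. (v q)\<^sup>2))"
    by (intro sum_mono Cauchy_Schwarz_sum)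
  finally show ?thesis
    by (simp add: sum_distrib_right ip_def power2_eq_square)
qed

section \<open>Exponential decay of the inverse of a graph-local operator\<close>

text \<open>\<open>S t\<close> abstracts the indices within \<open>t\<close> steps of the support of
  \<open>e\<close>. The series is never summed: the iterates \<open>M^n y\<close> are followed
  instead. They contract in norm, while one step changes them by \<open>-c H (M^n e)\<close>, which
  lives on \<open>S (2 n + 1)\<close> and so leaves \<open>I\<close> untouched during the first
  \<open>k\<close> steps. Hence \<open>y\<close> and \<open>M^k y\<close> agree on \<open>I\<close>.
  The assumption \<open>far\<close> speaks of \<open>k = Suc t\<close> so that \<open>k = 0\<close>
  imposes nothing.\<close>

lemma inverse_decay:
  fixes H :: "'a \<Rightarrow> 'a \<Rightarrow> real"
  assumes fin: "finite B" and sym: "\<forall>p\<in>B. \<forall>q\<in>B. H p q = H q p"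
    and a: "0 < a" "a \<le> b"
    and lower: "\<And>v. a * ip B v v \<le> ip B (mv B H v) (mv B H v)"
    and upper: "\<And>v. ip B (mv B H v) (mv B H v) \<le> b * ip B v v"
    and y: "\<And>p. p \<in> B \<Longrightarrow> mv B H y p = e p"
    and supp: "\<And>p. p \<in> B \<Longrightarrow> p \<notin> S 0 \<Longrightarrow> e p = 0"
    and mono: "\<And>t. S t \<subseteq> S (Suc t)"
    and step: "\<And>t p q. p \<in> B \<Longrightarrow> q \<in> B \<Longrightarrow> q \<in> S t \<Longrightarrow> H p q \<noteq> 0 \<Longrightarrow> p \<in> S (Suc t)"
    and far: "\<And>t. k = Suc t \<Longrightarrow> I \<inter> S (Suc (2 * t)) = {}"
    and I: "I \<subseteq> B"
  shows "L2_set y I \<le> ((b - a) / (b + a)) ^ k * (L2_set e B / sqrt a)"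
proof -
  define c where "c = 2 / (a + b)"
  define \<rho> where "\<rho> = (b - a) / (b + a)"
  define N where "N = mv B H"
  define M where "M = (\<lambda>v p. v p + (-c) * N (N v) p)"
  define ys where "ys n = (M ^^ n) y" for n
  define es where "es n = (M ^^ n) e" for n
  have \<rho>: "0 \<le> \<rho>" using a by (simp add: \<rho>_def)
  have N: "sym_op B N" unfolding N_def using sym by (rule sym_op_mv)
  have Nlin: "N (\<lambda>q. u q + d * v q) p = N u p + d * N v p" for u v d p
    by (simp add: N_def mv_add_scaled)
  have Nsym: "ip B u (N v) = ip B (N u) v" for u v
    using N by (simp add: sym_op_def)
  have Ncong: "(\<And>q. q \<in> B \<Longrightarrow> u q = v q) \<Longrightarrow> N u p = N v p" for u v p
    unfolding N_def by (rule mv_cong)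
  have NNlin: "N (N (\<lambda>q. u q + d * v q)) p = N (N u) p + d * N (N v) p" for u v d p
    using Nlin by (metis (no_types, lifting) Ncong)
  have Mform: "ip B u (M v) = ip B u v - c * ip B (N u) (N v)" for u v
    by (simp add: M_def ip_add_scaled_right Nsym del: mult_minus_left)
  have M: "sym_op B M"
  proof -
    have "linear_op B M"
      by (simp add: linear_op_def M_def NNlin algebra_simps)
    moreover have "ip B u (M v) = ip B (M u) v" for u v
      unfolding ip_commute[of B "M u"] Mform by (simp add: ip_commute)
    ultimately show ?thesis by (simp add: sym_op_def)
  qed
  have Mcontr: "ip B (M v) (M v) \<le> \<rho>\<^sup>2 * ip B v v" for v
  proof (rule norm_le_of_quadratic_form_le[OF M \<rho>])
    fix v
    have "c * (a * ip B v v) \<le> c * ip B (N v) (N v)" "c * ip B (N v) (N v) \<le> c * (b * ip B v v)"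
      using lower[of v] upper[of v] a
      by (auto simp: N_def c_def intro!: divide_right_mono)
    moreover have "c * a = 1 - \<rho>" "c * b = 1 + \<rho>"
      using a by (simp_all add: c_def \<rho>_def field_simps)
    then have "c * (a * ip B v v) = (1 - \<rho>) * ip B v v" "c * (b * ip B v v) = (1 + \<rho>) * ip B v v"
      by (simp_all only: mult.assoc[symmetric])
    ultimately show "\<bar>ip B v (M v)\<bar> \<le> \<rho> * ip B v v"
      unfolding Mform by (simp add: abs_le_iff algebra_simps)
  qed
  have ys_norm: "L2_set (ys n) B \<le> \<rho> ^ n * L2_set y B" for n
  proof (induction n)
    case (Suc n)
    have "(L2_set (ys (Suc n)) B)\<^sup>2 \<le> (\<rho> * L2_set (ys n) B)\<^sup>2"
      using Mcontr[of "ys n"] by (simp add: L2_set_power2 power_mult_distrib ys_def)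
    then have "L2_set (ys (Suc n)) B \<le> \<rho> * L2_set (ys n) B"
      by (rule power2_le_imp_le) (simp add: \<rho>)
    also have "\<dots> \<le> \<rho> * (\<rho> ^ n * L2_set y B)"
      using Suc \<rho> by (rule mult_left_mono)
    finally show ?case by simp
  qed (simp add: ys_def)
  \<comment> \<open>\<open>M\<close> is a polynomial in \<open>H\<close>, so the two commute and
    \<open>H (M^n y) = M^n (H y)\<close>; the claim is confined to \<open>B\<close> because
    \<open>y\<close> solves the system only there.\<close>
  have N_ys: "p \<in> B \<Longrightarrow> N (ys n) p = es n p" for n p
  proof (induction n arbitrary: p)
    case 0
    then show ?case using y by (simp add: ys_def es_def N_def)
  next
    case (Suc n)
    have "ys (Suc n) = (\<lambda>p. ys n p + (-c) * N (N (ys n)) p)"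
      by (simp add: ys_def M_def)
    then have "N (ys (Suc n)) p = N (ys n) p + (-c) * N (N (N (ys n))) p"
      by (simp only: Nlin)
    also have "N (N (N (ys n))) p = N (N (es n)) p"
      by (intro Ncong Suc.IH) 
    finally show ?case using Suc by (simp add: es_def M_def)
  qed
  have N_supp: "(\<And>q. q \<in> B \<Longrightarrow> q \<notin> S t \<Longrightarrow> v q = 0) \<Longrightarrow> p \<in> B \<Longrightarrow> p \<notin> S (Suc t) \<Longrightarrow> N v p = 0"
    for v t p
    unfolding N_def mv_def using step by (intro sum.neutral) fastforce
  \<comment> \<open>\<open>M\<close> contains \<open>H\<close> twice, so each iteration enlarges the
    support by two steps.\<close>
  have es_supp: "p \<in> B \<Longrightarrow> p \<notin> S (2 * n) \<Longrightarrow> es n p = 0" for n p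
  proof (induction n arbitrary: p)
    case 0
    then show ?case using supp by (simp add: es_def)
  next
    case (Suc n)
    have "N (N (es n)) p = 0"
      using Suc by (intro N_supp[of "Suc (2 * n)"] N_supp[of "2 * n"]) auto
    moreover have "p \<notin> S (2 * n)"
      using Suc.prems mono[of "2 * n"] mono[of "Suc (2 * n)"] by auto
    then have "es n p = 0" using Suc by blast
    ultimately show ?case by (simp add: es_def M_def)
  qed
  \<comment> \<open>Since \<open>H (ys n) = es n\<close>, the increment is a multiple of
    \<open>H (es n)\<close>: one more step, hence the odd index \<open>2 n + 1\<close>, which is at
    most \<open>2 k - 1\<close> while \<open>n < k\<close>.\<close>
  have ys_eq: "n \<le> k \<Longrightarrow> p \<in> I \<Longrightarrow> ys n p = y p" for n p
  proof (induction n)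
    case (Suc n)
    have S_mono: "t \<le> t' \<Longrightarrow> S t \<subseteq> S t'" for t t'
      using mono by (rule lift_Suc_mono_le)
    obtain t where k: "k = Suc t" using Suc.prems by (cases k) auto
    have "N (N (ys n)) p = N (es n) p"
      using N_ys by (intro Ncong) auto
    also have "\<dots> = 0"
    proof (rule N_supp[of "2 * n"])
      show "p \<in> B" using Suc I by auto
      show "p \<notin> S (Suc (2 * n))"
        using far[OF k] S_mono[of "Suc (2 * n)" "Suc (2 * t)"] Suc.prems k by auto
    qed (use es_supp in auto)
    finally show ?case using Suc by (simp add: ys_def M_def)
  qed (simp add: ys_def)
  have "L2_set y I = L2_set (ys k) I"
    using ys_eq by (intro L2_set_cong) auto
  also have "\<dots> \<le> L2_set (ys k) B"
    unfolding L2_set_def using fin I by (intro real_sqrt_le_mono sum_mono2) auto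
  also have "\<dots> \<le> \<rho> ^ k * L2_set y B" by (rule ys_norm)
  also have "\<dots> \<le> \<rho> ^ k * (L2_set e B / sqrt a)"
  proof (intro mult_left_mono)
    have "ip B (mv B H y) (mv B H y) = ip B e e" using y by (intro ip_cong) auto
    with lower[of y] have "(L2_set y B * sqrt a)\<^sup>2 \<le> (L2_set e B)\<^sup>2"
      using a by (simp add: L2_set_power2 power_mult_distrib mult.commute)
    then have "L2_set y B * sqrt a \<le> L2_set e B"
      by (rule power2_le_imp_le) simp
    then show "L2_set y B \<le> L2_set e B / sqrt a" using a by (simp add: pos_le_divide_eq)
  qed (use \<rho> in simp)
  finally show ?thesis by (simp add: \<rho>_def)
qed

section \<open>Singular values bound the operator\<close>

abbreviation mat_op :: "real mat \<Rightarrow> (nat \<Rightarrow> real) \<Rightarrow> nat \<Rightarrow> real" where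
  "mat_op A \<equiv> mv {..<dim_col A} (\<lambda>p q. A $$ (p, q))"

lemma mult_mat_vec_eq_mat_op:
  "w \<in> carrier_vec (dim_col A) \<Longrightarrow> p < dim_row A \<Longrightarrow> (A *\<^sub>v w) $ p = mat_op A (($) w) p"
  by (auto simp: mv_def scalar_prod_def row_def atLeast0LessThan intro!: sum.cong)

lemma mat_op_mult:
  assumes "A \<in> carrier_mat n m" "C \<in> carrier_mat m k" "p < n"
  shows "mat_op (A * C) v p = mat_op A (mat_op C v) p"
proof -
  have "mat_op (A * C) v p = ((A * C) *\<^sub>v vec k v) $ p"
    using assms by (subst mult_mat_vec_eq_mat_op) (auto intro!: mv_cong)
  also have "(A * C) *\<^sub>v vec k v = A *\<^sub>v (C *\<^sub>v vec k v)"
    using assms by (intro assoc_mult_mat_vec) auto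
  also have "\<dots> $ p = mat_op A (($) (C *\<^sub>v vec k v)) p"
    using assms by (intro mult_mat_vec_eq_mat_op) auto
  also have "\<dots> = mat_op A (mat_op C v) p"
    using assms by (intro mv_cong) (subst mult_mat_vec_eq_mat_op, auto intro!: mv_cong)
  finally show ?thesis .
qed

lemma mat_op_one:
  assumes "p < k" shows "mat_op (1\<^sub>m k) v p = v p"
proof -
  have "mat_op (1\<^sub>m k) v p = (\<Sum>q<k. if q = p then v q else 0)"
    using assms unfolding mv_def by (intro sum.cong) auto
  with assms show ?thesis by simp
qed

lemma ip_transpose_mult:
  assumes M: "M \<in> carrier_mat k k"
  shows "ip {..<k} v (mat_op (M\<^sup>T * M) v) = ip {..<k} (mat_op M v) (mat_op M v)"
proof -
  have "ip {..<k} v (mat_op (M\<^sup>T * M) v) = ip {..<k} v (mat_op (M\<^sup>T) (mat_op M v))"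
    using M by (intro ip_cong mat_op_mult[of _ k k _ k]) auto
  also have "\<dots> = (\<Sum>p<k. \<Sum>q<k. v p * (M $$ (q, p) * mat_op M v q))"
    using M by (auto simp: ip_def mv_def[of _ "\<lambda>p q. M\<^sup>T $$ (p, q)"] sum_distrib_left intro!: sum.cong)
  also have "\<dots> = (\<Sum>q<k. \<Sum>p<k. v p * (M $$ (q, p) * mat_op M v q))"
    by (rule sum.swap)
  also have "\<dots> = (\<Sum>q<k. mat_op M v q * mat_op M v q)"
    using M by (subst (3) mv_def) (simp add: sum_distrib_left sum_distrib_right mult_ac)
  finally show ?thesis by (simp add: ip_def)
qed

lemma eigenvector_mat_op:
  assumes A: "A \<in> carrier_mat k k" and "eigenvalue A e"
  obtains w where "\<And>p. p < k \<Longrightarrow> mat_op A w p = e * w p" "0 < ip {..<k} w w"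
proof -
  from assms obtain w where w: "w \<in> carrier_vec k" "w \<noteq> 0\<^sub>v k" "A *\<^sub>v w = e \<cdot>\<^sub>v w"
    by (auto simp: eigenvalue_def eigenvector_def)
  show thesis
  proof (rule that[of "($) w"])
    fix p assume "p < k"
    then show "mat_op A (($) w) p = e * w $ p"
      using mult_mat_vec_eq_mat_op[of w A p] A w by auto
  next
    have "ip {..<k} (($) w) (($) w) \<noteq> 0"
      using w(1,2) by (auto simp: ip_self_eq_0_iff vec_eq_iff)
    then show "0 < ip {..<k} (($) w) (($) w)" using ip_nonneg[of "{..<k}" "($) w"] by linarith
  qed
qed

lemma ip_scale: "ip B (\<lambda>p. s * u p) (\<lambda>p. s * v p) = s\<^sup>2 * ip B u v"
  by (simp add: ip_def sum_distrib_left power2_eq_square mult_ac)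

lemma mv_scale: "mv B H (\<lambda>p. s * v p) = (\<lambda>p. s * mv B H v p)"
  by (simp add: mv_def sum_distrib_left mult_ac fun_eq_iff)

text \<open>Nonnegativity of \<open>|v + H v|^2\<close> and \<open>|v - H v|^2\<close> bounds twice
  the form by \<open>|v|^2 + |H v|^2\<close>, and the Frobenius bound absorbs the last term.
  Symmetry of \<open>H\<close> does not enter this computation.\<close>

lemma quadratic_form_bounded:
  assumes "finite B"
  obtains C where "C > 0" "\<And>v. \<bar>ip B v (mv B H v)\<bar> \<le> C * ip B v v"
proof
  let ?F = "\<Sum>p\<in>B. \<Sum>q\<in>B. (H p q)\<^sup>2"
  have F: "0 \<le> ?F" by (simp add: sum_nonneg)
  then show "(1 + ?F) / 2 > 0" by simp
  fix v
  have "0 \<le> ip B v v + 2 * c * ip B v (mv B H v) + c\<^sup>2 * ip B (mv B H v) (mv B H v)" for c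
    using ip_nonneg[of B "\<lambda>p. v p + c * mv B H v p"]
    by (simp add: ip_add_scaled_left ip_add_scaled_right ip_commute[of B "mv B H v" v]
        algebra_simps power2_eq_square)
  from this[of 1] this[of "-1"] mv_norm_le[OF assms, of H v]
  show "\<bar>ip B v (mv B H v)\<bar> \<le> (1 + ?F) / 2 * ip B v v"
    by (simp add: abs_le_iff algebra_simps)
qed

text \<open>The infimum of the Rayleigh quotient is an eigenvalue without any compactness argument:
  otherwise the shifted operator would be invertible and positive semidefinite, hence coercive,
  and the quotient would stay away from its infimum.\<close>

lemma least_eigenvalue:
  fixes A :: "real mat"
  assumes A: "A \<in> carrier_mat k k" and k: "0 < k"
    and sym: "\<And>p q. p < k \<Longrightarrow> q < k \<Longrightarrow> A $$ (p, q) = A $$ (q, p)"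
  obtains e where "eigenvalue A e" "\<And>v. e * ip {..<k} v v \<le> ip {..<k} v (mat_op A v)"
proof -
  let ?B = "{..<k}"
  define f where "f v = ip ?B v (mat_op A v)" for v
  have dim: "dim_col A = k" "dim_row A = k" using A by auto
  obtain C where C: "C > 0" "\<And>v. \<bar>f v\<bar> \<le> C * ip ?B v v"
    using quadratic_form_bounded[of ?B "\<lambda>p q. A $$ (p, q)"] by (auto simp: f_def dim)
  define R where "R = f ` {v. ip ?B v v = 1}"
  define \<mu> where "\<mu> = Inf R"
  have "ip ?B (\<lambda>p. if p = 0 then 1 else 0) (\<lambda>p. if p = 0 then 1 else 0) = 1"
    using k by (simp add: ip_def if_distrib[of "\<lambda>x. x * _"] cong: if_cong)
  then have R_ne: "R \<noteq> {}" unfolding R_def by blast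
  have R_ge: "- C \<le> r" if "r \<in> R" for r
  proof -
    from that obtain v where v: "ip ?B v v = 1" "r = f v" by (auto simp: R_def)
    then show ?thesis using C(2)[of v] by (simp add: abs_le_iff)
  qed
  have \<mu>: "\<mu> * ip ?B v v \<le> f v" for v
  proof (cases "ip ?B v v = 0")
    case True
    then show ?thesis using C(2)[of v] by simp
  next
    case False
    then have pos: "ip ?B v v > 0" using ip_nonneg[of ?B v] by linarith
    define s where "s = 1 / sqrt (ip ?B v v)"
    have s2: "s\<^sup>2 = 1 / ip ?B v v" using pos by (simp add: s_def power_divide)
    have "ip ?B (\<lambda>p. s * v p) (\<lambda>p. s * v p) = 1"
      using pos by (simp add: ip_scale s2)
    then have "f (\<lambda>p. s * v p) \<in> R" unfolding R_def by blast
    then have "\<mu> \<le> f (\<lambda>p. s * v p)"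
      unfolding \<mu>_def using R_ge by (intro cInf_lower) (auto simp: bdd_below_def)
    also have "\<dots> = f v / ip ?B v v" by (simp add: f_def mv_scale ip_scale s2)
    finally show ?thesis using pos by (simp add: field_simps)
  qed
  have "eigenvalue A \<mu>"
  proof (rule ccontr)
    assume "\<not> eigenvalue A \<mu>"
    then have "det (char_matrix A \<mu>) \<noteq> 0" using eigenvalue_det[OF A] by simp
    moreover have cA: "char_matrix A \<mu> \<in> carrier_mat k k" using A by simp
    ultimately have "char_matrix A \<mu> \<in> Units (ring_mat TYPE(real) k ())"
      by (intro det_non_zero_imp_unit)
    then obtain P where P: "P \<in> carrier_mat k k" "P * char_matrix A \<mu> = 1\<^sub>m k"
      unfolding Units_def ring_mat_def by auto
    define T where "T = (\<lambda>v p. mat_op A v p + (-\<mu>) * v p)"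
    have "sym_op ?B (mat_op A)" unfolding dim using sym by (intro sym_op_mv) auto
    then have T: "sym_op ?B T"
      unfolding T_def sym_op_def linear_op_def ip_add_scaled_left ip_add_scaled_right
      by (auto simp: algebra_simps)
    have ip_T: "ip ?B v (T v) = f v - \<mu> * ip ?B v v" for v
      by (simp add: T_def f_def ip_add_scaled_right del: mult_minus_left)
    \<comment> \<open>\<open>?C\<close> bounds the form of the shifted operator. \<open>?K\<close>
      bounds the squared norm of its inverse \<open>P\<close>; the added 1 makes it positive at
      once.\<close>
    let ?C = "C + \<bar>\<mu>\<bar>" and ?K = "1 + (\<Sum>p\<in>?B. \<Sum>q\<in>?B. (P $$ (p, q))\<^sup>2)"
    have K: "?K > 0" by (intro add_pos_nonneg sum_nonneg) auto
    have coercive: "ip ?B v v \<le> ?C * ?K * ip ?B v (T v)" for v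
    proof (rule quadratic_form_coercive[OF T])
      fix v
      show "0 \<le> ip ?B v (T v)" using \<mu>[of v] by (simp add: ip_T)
      have "- \<mu> * ip ?B v v \<le> \<bar>\<mu>\<bar> * ip ?B v v"
        by (intro mult_right_mono ip_nonneg) simp
      then show "ip ?B v (T v) \<le> ?C * ip ?B v v"
        using C(2)[of v] by (simp add: ip_T algebra_simps abs_le_iff)
      have "v p = mat_op P (T v) p" if p: "p < k" for p
      proof -
        have "mat_op (char_matrix A \<mu>) v q = T v q" if "q < k" for q
        proof -
          have "mat_op (char_matrix A \<mu>) v q
              = (\<Sum>r<k. A $$ (q, r) * v r + (if r = q then - \<mu> * v r else 0))"
            using that A unfolding mv_def char_matrix_def
            by (intro sum.cong) (auto simp: algebra_simps)
          also have "\<dots> = T v q"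
            using that by (simp add: T_def mv_def dim sum.distrib)
          finally show ?thesis .
        qed
        then have "mat_op P (T v) p = mat_op P (mat_op (char_matrix A \<mu>) v) p"
          using P by (intro mv_cong) auto
        also have "\<dots> = mat_op (1\<^sub>m k) v p"
          using mat_op_mult[OF P(1) cA p] P(2) by simp
        also have "\<dots> = v p" using p by (rule mat_op_one)
        finally show ?thesis by simp
      qed
      then have "ip ?B v v = ip ?B (mat_op P (T v)) (mat_op P (T v))"
        by (intro ip_cong) auto
      also have "\<dots> \<le> (\<Sum>p\<in>?B. \<Sum>q\<in>?B. (P $$ (p, q))\<^sup>2) * ip ?B (T v) (T v)"
        using mv_norm_le[of ?B "\<lambda>p q. P $$ (p, q)"] P by simp
      also have "\<dots> \<le> ?K * ip ?B (T v) (T v)"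
        by (intro mult_right_mono ip_nonneg) simp
      finally show "ip ?B v v \<le> ?K * ip ?B (T v) (T v)" .
    qed (use C(1) K in auto)
    have CK: "?C * ?K > 0" using C(1) K by (intro mult_pos_pos) auto
    have "\<mu> + 1 / (?C * ?K) \<le> r" if r: "r \<in> R" for r
    proof -
      obtain v where v: "ip ?B v v = 1" "r = f v" using r by (auto simp: R_def)
      with coercive[of v] have "1 \<le> ?C * ?K * (r - \<mu>)" by (simp add: ip_T)
      then have "1 / (?C * ?K) \<le> r - \<mu>" using CK by (simp add: field_simps)
      then show ?thesis by simp
    qed
    then have "\<mu> + 1 / (?C * ?K) \<le> \<mu>"
      unfolding \<mu>_def using R_ne by (intro cInf_greatest) auto
    moreover have "1 / (?C * ?K) > 0" using CK by simp
    ultimately show False by linarith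
  qed
  then show thesis using \<mu> that by (auto simp: f_def)
qed

text \<open>The extremes of the Rayleigh quotient of \<open>M^T M\<close> are eigenvalues
  \<open>e1\<close> and \<open>e2\<close>, and every eigenvalue lies between them; so the least and
  greatest singular values are their square roots. An injective \<open>M\<close> cannot have
  \<open>e1 = 0\<close>, since an eigenvector for it would be sent to zero.\<close>

lemma singular_value_bounds:
  fixes M :: "real mat"
  assumes M: "M \<in> carrier_mat k k" and k: "0 < k"
  shows "(sigma_min M)\<^sup>2 * ip {..<k} v v \<le> ip {..<k} (mat_op M v) (mat_op M v)"
    and "ip {..<k} (mat_op M v) (mat_op M v) \<le> (sigma_max M)\<^sup>2 * ip {..<k} v v"
    and "sigma_min M \<le> sigma_max M"
    and "\<lbrakk>\<And>u. (\<And>p. p < k \<Longrightarrow> mat_op M u p = 0) \<Longrightarrow> (\<And>p. p < k \<Longrightarrow> u p = 0)\<rbrakk> \<Longrightarrow> 0 < sigma_min M"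
proof -
  let ?B = "{..<k}" and ?A = "M\<^sup>T * M"
  have A: "?A \<in> carrier_mat k k" using M by auto
  have sym: "?A $$ (p, q) = ?A $$ (q, p)" if "p < k" "q < k" for p q
  proof -
    have "?A\<^sup>T = ?A" using M by (simp add: transpose_mult[of _ k k _ k])
    then show ?thesis using that A by (metis carrier_matD index_transpose_mat(1))
  qed
  note ip_A = ip_transpose_mult[OF M]
  have ev: "\<exists>w. ip ?B w w > 0 \<and> e * ip ?B w w = ip ?B (mat_op M w) (mat_op M w)"
    if e: "eigenvalue ?A e" for e
  proof -
    obtain w where w: "\<And>p. p < k \<Longrightarrow> mat_op ?A w p = e * w p" "0 < ip ?B w w"
      using eigenvector_mat_op[OF A e] by blast
    have "ip ?B w (mat_op ?A w) = ip ?B w (\<lambda>p. e * w p)"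
      using w by (intro ip_cong) auto
    also have "\<dots> = e * ip ?B w w"
      using ip_add_scaled_right[of ?B w "\<lambda>_. 0" e w] by (simp add: ip_def)
    finally show ?thesis using w(2) unfolding ip_A by auto
  qed
  obtain e1 where e1: "eigenvalue ?A e1" "\<And>v. e1 * ip ?B v v \<le> ip ?B v (mat_op ?A v)"
    using least_eigenvalue[OF A k sym] by blast
  \<comment> \<open>The greatest eigenvalue is obtained as minus the least eigenvalue of the negated
    matrix.\<close>
  have mA: "- ?A \<in> carrier_mat k k" using A by auto
  obtain e2' where e2': "eigenvalue (- ?A) e2'" "\<And>v. e2' * ip ?B v v \<le> ip ?B v (mat_op (- ?A) v)"
    by (rule least_eigenvalue[OF mA k]) (use sym A in auto)
  define e2 where "e2 = - e2'"
  have minus: "ip ?B v (mat_op (- ?A) v) = - ip ?B v (mat_op ?A v)" for v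
  proof -
    have "mat_op (- ?A) v p = - mat_op ?A v p" if "p < k" for p
      using that M unfolding mv_def sum_negf[symmetric] by (intro sum.cong) auto
    then show ?thesis unfolding ip_def sum_negf[symmetric] by (intro sum.cong) auto
  qed
  have e2: "eigenvalue ?A e2"
  proof -
    obtain w where "w \<in> carrier_vec k" "w \<noteq> 0\<^sub>v k" "- ?A *\<^sub>v w = e2' \<cdot>\<^sub>v w"
      using e2'(1) M by (auto simp: eigenvalue_def eigenvector_def)
    moreover from this have "?A *\<^sub>v w = e2 \<cdot>\<^sub>v w"
    proof (intro eq_vecI)
      fix p assume p: "p < dim_vec (e2 \<cdot>\<^sub>v w)"
      have "- (?A *\<^sub>v w) = e2' \<cdot>\<^sub>v w"
        using calculation A by (metis uminus_mult_mat_vec carrier_matD(2) carrier_vecD)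
      from arg_cong[OF this, of "\<lambda>u. u $ p"] show "(?A *\<^sub>v w) $ p = (e2 \<cdot>\<^sub>v w) $ p"
        using p calculation(1) carrier_matD[OF M] by (simp add: e2_def)
    qed (use calculation(1) carrier_matD[OF M] in auto)
    ultimately show ?thesis using M by (auto simp: eigenvalue_def eigenvector_def)
  qed
  have upper: "ip ?B (mat_op M v) (mat_op M v) \<le> e2 * ip ?B v v" for v
    using e2'(2)[of v] unfolding minus ip_A by (simp add: e2_def)
  have lower: "e1 * ip ?B v v \<le> ip ?B (mat_op M v) (mat_op M v)" for v
    using e1(2)[of v] unfolding ip_A .
  have between: "e1 \<le> e" "e \<le> e2" "0 \<le> e" if e: "eigenvalue ?A e" for e
  proof -
    obtain w where w: "ip ?B w w > 0" "e * ip ?B w w = ip ?B (mat_op M w) (mat_op M w)"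
      using ev[OF e] by blast
    have "e1 * ip ?B w w \<le> e * ip ?B w w" using lower[of w] w(2) by simp
    then show "e1 \<le> e" using w(1) by simp
    have "e * ip ?B w w \<le> e2 * ip ?B w w" using upper[of w] w(2) by simp
    then show "e \<le> e2" using w(1) by simp
    have "0 \<le> e * ip ?B w w" using w ip_nonneg[of ?B "mat_op M w"] by simp
    with w(1) show "0 \<le> e" by (simp add: zero_le_mult_iff)
  qed
  \<comment> \<open>\<open>Min\<close> and \<open>Max\<close> carry their meaning only on finite
    sets; the eigenvalues are roots of a monic polynomial of positive degree.\<close>
  have fin: "finite (singular_values M)"
  proof -
    have "finite {e. eigenvalue ?A e}"
      unfolding eigenvalue_root_char_poly[OF A]
      using degree_monic_char_poly[OF A] k by (intro poly_roots_finite) auto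
    moreover have "singular_values M = sqrt ` {e. eigenvalue ?A e}"
      by (auto simp: singular_values_def)
    ultimately show ?thesis by simp
  qed
  have smin: "sigma_min M = sqrt e1"
    unfolding sigma_min_def using fin e1(1) between
    by (intro Min_eqI) (auto simp: singular_values_def)
  have smax: "sigma_max M = sqrt e2"
    unfolding sigma_max_def using fin e2 between
    by (intro Max_eqI) (auto simp: singular_values_def)
  show "(sigma_min M)\<^sup>2 * ip ?B v v \<le> ip ?B (mat_op M v) (mat_op M v)"
    using lower between(3)[OF e1(1)] by (simp add: smin)
  show "ip ?B (mat_op M v) (mat_op M v) \<le> (sigma_max M)\<^sup>2 * ip ?B v v"
    using upper between(3)[OF e2] by (simp add: smax)
  show "sigma_min M \<le> sigma_max M"
    using between(1)[OF e2] by (simp add: smin smax)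
  show "0 < sigma_min M"
    if inj: "\<And>u. (\<And>p. p < k \<Longrightarrow> mat_op M u p = 0) \<Longrightarrow> (\<And>p. p < k \<Longrightarrow> u p = 0)"
  proof -
    obtain w where w: "ip ?B w w > 0" "e1 * ip ?B w w = ip ?B (mat_op M w) (mat_op M w)"
      using ev[OF e1(1)] by blast
    have "e1 \<noteq> 0"
    proof
      assume "e1 = 0"
      then have "\<forall>p\<in>?B. mat_op M w p = 0"
        using w by (simp add: ip_self_eq_0_iff)
      then have "\<forall>p\<in>?B. w p = 0" using inj by blast
      then show False using w by (simp add: ip_def)
    qed
    then show ?thesis using between(3)[OF e1(1)] by (simp add: smin)
  qed
qed

section \<open>Optimality conditions on flat index sets\<close>

text \<open>\<open>X\<close>, \<open>E\<close> and \<open>I\<close> index the primal variables, the equality and the inequality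
  multipliers. One matrix \<open>H\<close> holds \<open>Q\<close> on \<open>X \<times> X\<close> and the constraint rows on
  \<open>(E \<union> I) \<times> X\<close>.\<close>

locale kkt_system =
  fixes X E I :: "'a set" and H :: "'a \<Rightarrow> 'a \<Rightarrow> real"
  assumes fin: "finite X" "finite E" "finite I"
    and disj: "X \<inter> E = {}" "X \<inter> I = {}" "E \<inter> I = {}"
    and H_sym: "\<forall>p\<in>X \<union> E \<union> I. \<forall>q\<in>X \<union> E \<union> I. H p q = H q p"
    and H_zero: "\<forall>p\<in>E \<union> I. \<forall>q\<in>E \<union> I. H p q = 0"
begin

definition kkt :: "('a \<Rightarrow> real) \<Rightarrow> ('a \<Rightarrow> real) \<Rightarrow> bool" where
  "kkt d z \<longleftrightarrow> (\<forall>p\<in>X. mv X H z p + mv (E \<union> I) H z p = d p) \<and> (\<forall>p\<in>E. mv X H z p = d p) \<and>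
     (\<forall>p\<in>I. d p \<le> mv X H z p \<and> z p \<le> 0 \<and> z p * (mv X H z p - d p) = 0)"

definition sosc :: "('a \<Rightarrow> real) \<Rightarrow> ('a \<Rightarrow> real) \<Rightarrow> bool" where
  "sosc d z \<longleftrightarrow> (\<forall>w. (\<forall>p\<in>E. mv X H w p = 0) \<longrightarrow>
     (\<forall>p\<in>I. mv X H z p = d p \<longrightarrow> (if z p < 0 then mv X H w p = 0 else 0 \<le> mv X H w p)) \<longrightarrow>
     (\<exists>p\<in>X. w p \<noteq> 0) \<longrightarrow> 0 < ip X w (mv X H w))"

text \<open>Independence of the active rows in dual form: \<open>\<mu>\<close> holds the
  coefficients of a vanishing combination of rows, and those of inactive inequalities are
  zero.\<close>

definition licq :: "('a \<Rightarrow> real) \<Rightarrow> ('a \<Rightarrow> real) \<Rightarrow> bool" where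
  "licq d z \<longleftrightarrow> (\<forall>\<mu>. (\<forall>p\<in>X. mv (E \<union> I) H \<mu> p = 0) \<longrightarrow>
     (\<forall>p\<in>I. mv X H z p \<noteq> d p \<longrightarrow> \<mu> p = 0) \<longrightarrow> (\<forall>p\<in>E \<union> I. \<mu> p = 0))"

text \<open>Active inequalities with zero multiplier are included as well. Their rows then
  annihilate the primal part of a kernel vector, which places it in the critical cone.\<close>

definition active_basis :: "('a \<Rightarrow> real) \<Rightarrow> ('a \<Rightarrow> real) \<Rightarrow> 'a set" where
  "active_basis d z = X \<union> E \<union> {p \<in> I. mv X H z p = d p}"

lemma ip_adjoint: "ip X u (mv (E \<union> I) H \<mu>) = ip (E \<union> I) \<mu> (mv X H u)"
proof -
  have "ip X u (mv (E \<union> I) H \<mu>) = (\<Sum>p\<in>X. \<Sum>q\<in>E \<union> I. u p * (H p q * \<mu> q))"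
    by (simp add: ip_def mv_def sum_distrib_left)
  also have "\<dots> = (\<Sum>q\<in>E \<union> I. \<Sum>p\<in>X. u p * (H p q * \<mu> q))"
    by (rule sum.swap)
  also have "\<dots> = (\<Sum>q\<in>E \<union> I. \<Sum>p\<in>X. \<mu> q * (H q p * u p))"
    using H_sym by (intro sum.cong refl) (auto simp: mult_ac)
  finally show ?thesis by (simp add: ip_def mv_def sum_distrib_left)
qed

text \<open>For the difference \<open>w\<close> of two solutions, stationarity and adjointness give
  \<open><w, Q w> = - \<Sum> w_q (A w)_q\<close> over the inequalities. Complementarity makes every
  summand nonnegative and \<open>Q\<close> is positive semidefinite, so both sides vanish. Then
  \<open>w\<close> lies in the critical cone at \<open>z\<close>, SOSC removes its primal part, and
  LICQ removes its multipliers.\<close>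

lemma kkt_unique:
  assumes psd: "\<And>w. 0 \<le> ip X w (mv X H w)"
    and z: "kkt d z" "sosc d z" "licq d z" and z': "kkt d z'"
    and p: "p \<in> X \<union> E \<union> I"
  shows "z' p = z p"
proof -
  define w where "w = (\<lambda>p. z' p + (-1) * z p)"
  have mv_w: "mv B H w q = mv B H z' q - mv B H z q" for B q
    unfolding w_def mv_add_scaled by simp
  have sign: "0 \<le> - z' q * (mv X H z q - d q)" "0 \<le> - z q * (mv X H z' q - d q)"
    if "q \<in> I" for q
    using that z(1) z' unfolding kkt_def by (auto intro!: mult_nonpos_nonneg)
  have prod_eq: "w q * mv X H w q = - z' q * (mv X H z q - d q) + (- z q * (mv X H z' q - d q))"
    if "q \<in> I" for q
  proof -
    have "z q * mv X H z q = z q * d q" "z' q * mv X H z' q = z' q * d q"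
      using that z(1) z' by (auto simp: kkt_def)
    then show ?thesis unfolding mv_w by (auto simp: w_def left_diff_distrib right_diff_distrib)
  qed
  have sum_I: "ip (E \<union> I) w (mv X H w) = (\<Sum>q\<in>I. w q * mv X H w q)"
  proof -
    have "ip E w (mv X H w) = 0"
      unfolding ip_def mv_w using z(1) z' by (intro sum.neutral) (auto simp: kkt_def)
    then show ?thesis using fin disj by (simp add: ip_def sum.union_disjoint)
  qed
  have X_eq: "mv X H w q + mv (E \<union> I) H w q = 0" if "q \<in> X" for q
  proof -
    have "mv X H z q + mv (E \<union> I) H z q = d q" "mv X H z' q + mv (E \<union> I) H z' q = d q"
      using that z(1) z' by (auto simp: kkt_def)
    then show ?thesis unfolding mv_w by linarith
  qed
  have "ip X w (mv X H w) = ip X w (\<lambda>p. 0 + (-1) * mv (E \<union> I) H w p)"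
    using X_eq by (intro ip_cong) (auto simp: eq_neg_iff_add_eq_0)
  also have "\<dots> = - ip (E \<union> I) w (mv X H w)"
    unfolding ip_add_scaled_right ip_adjoint by (simp add: ip_def)
  finally have form: "ip X w (mv X H w) = - (\<Sum>q\<in>I. w q * mv X H w q)"
    unfolding sum_I .
  have nonneg: "0 \<le> w q * mv X H w q" if "q \<in> I" for q
    using sign[OF that] prod_eq[OF that] by linarith
  then have "0 \<le> (\<Sum>q\<in>I. w q * mv X H w q)" by (rule sum_nonneg)
  with psd[of w] form have zero: "(\<Sum>q\<in>I. w q * mv X H w q) = 0" "ip X w (mv X H w) = 0"
    by linarith+
  \<comment> \<open>Cross-complementarity: a constraint with strictly negative multiplier at
    \<open>z\<close> is active at \<open>z'\<close> too. This gives the equality case in the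
    critical cone.\<close>
  have term0: "z q * (mv X H z' q - d q) = 0" if "q \<in> I" for q
  proof -
    have "w q * mv X H w q = 0"
      using zero(1) nonneg fin that by (simp add: sum_nonneg_eq_0_iff)
    then show ?thesis using sign[OF that] prod_eq[OF that] by simp
  qed
  have w_E: "\<forall>q\<in>E. mv X H w q = 0"
    unfolding mv_w using z(1) z' by (auto simp: kkt_def)
  have w_I: "\<forall>q\<in>I. mv X H z q = d q \<longrightarrow> (if z q < 0 then mv X H w q = 0 else 0 \<le> mv X H w q)"
    unfolding mv_w using term0 z' by (fastforce simp: kkt_def)
  have w_X: "w q = 0" if "q \<in> X" for q
    using z(2) w_E w_I zero(2) that by (force simp: sosc_def)
  have "\<forall>q\<in>X. mv (E \<union> I) H w q = 0"
  proof
    fix q assume "q \<in> X"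
    then have "mv X H w q + mv (E \<union> I) H w q = 0" by (rule X_eq)
    moreover have "mv X H w q = 0" unfolding mv_def using w_X by (intro sum.neutral) auto
    ultimately show "mv (E \<union> I) H w q = 0" by simp
  qed
  moreover have "\<forall>q\<in>I. mv X H z q \<noteq> d q \<longrightarrow> w q = 0"
  proof (intro ballI impI)
    \<comment> \<open>The primal parts already agree, so a constraint inactive at \<open>z\<close>
      is inactive at \<open>z'\<close>, and complementarity annuls both multipliers.\<close>
    fix q assume q: "q \<in> I" "mv X H z q \<noteq> d q"
    have "mv X H w q = 0" unfolding mv_def using w_X by (intro sum.neutral) auto
    then have "mv X H z' q = mv X H z q" unfolding mv_w by simp
    then have "z q = 0" "z' q = 0" using q z(1) z' by (fastforce simp: kkt_def)+
    then show "w q = 0" by (simp add: w_def)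
  qed
  ultimately have "\<forall>q\<in>E \<union> I. w q = 0" using z(3) by (auto simp: licq_def)
  with w_X p have "w p = 0" by auto
  then show ?thesis by (simp add: w_def)
qed

lemma active_basis_solution:
  assumes "kkt d z"
  shows "p \<in> X \<union> E \<union> I \<Longrightarrow> p \<notin> active_basis d z \<Longrightarrow> z p = 0"
    and "p \<in> active_basis d z \<Longrightarrow> mv (active_basis d z) H z p = d p"
proof -
  show out: "z p = 0" if "p \<in> X \<union> E \<union> I" "p \<notin> active_basis d z" for p
    using that assms by (auto simp: active_basis_def kkt_def)
  assume p: "p \<in> active_basis d z"
  then have pN: "p \<in> X \<union> E \<union> I" by (auto simp: active_basis_def)
  have "mv (active_basis d z) H z p = mv (X \<union> (E \<union> I)) H z p"
    unfolding mv_def using fin out by (intro sum.mono_neutral_left) (auto simp: active_basis_def)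
  also have "\<dots> = mv X H z p + mv (E \<union> I) H z p"
    unfolding mv_def using fin disj by (intro sum.union_disjoint) auto
  also have "\<dots> = d p"
  proof (cases "p \<in> X")
    case False
    then have "mv (E \<union> I) H z p = 0" unfolding mv_def using H_zero pN by (intro sum.neutral) auto
    then show ?thesis using False p assms by (auto simp: active_basis_def kkt_def)
  qed (use assms in \<open>auto simp: kkt_def\<close>)
  finally show "mv (active_basis d z) H z p = d p" .
qed

text \<open>The classical nonsingularity argument for KKT matrices. The active rows kill the primal
  part of a kernel vector, so pairing its stationarity rows with that part leaves a vanishing
  quadratic form; SOSC makes the primal part zero. What remains is a relation between active rows,
  excluded by LICQ.\<close>

lemma active_basis_nonsingular:
  assumes sosc: "sosc d z" and licq: "licq d z"
    and ker: "\<And>p. p \<in> active_basis d z \<Longrightarrow> mv (active_basis d z) H v p = 0"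
    and p: "p \<in> active_basis d z"
  shows "v p = 0"
proof -
  let ?B = "active_basis d z"
  \<comment> \<open>Extension by zero turns sums over the basis into sums over all of
    \<open>X\<close> and \<open>E \<union> I\<close>.\<close>
  define u where "u = (\<lambda>p. if p \<in> ?B then v p else 0)"
  have split: "mv ?B H v q = mv X H u q + mv (E \<union> I) H u q" for q
  proof -
    have "mv ?B H v q = mv ?B H u q" by (intro mv_cong) (simp add: u_def)
    also have "\<dots> = mv (X \<union> (E \<union> I)) H u q"
      unfolding mv_def using fin by (intro sum.mono_neutral_left) (auto simp: active_basis_def u_def)
    also have "\<dots> = mv X H u q + mv (E \<union> I) H u q"
      unfolding mv_def using fin disj by (intro sum.union_disjoint) auto
    finally show ?thesis .
  qed
  have rows: "mv X H u q = 0" if "q \<in> E \<union> I" "q \<in> ?B" for q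
  proof -
    have "mv (E \<union> I) H u q = 0" unfolding mv_def using H_zero that by (intro sum.neutral) auto
    then show ?thesis using split[of q] ker[of q] that by simp
  qed
  have X_B: "q \<in> ?B" if "q \<in> X" for q using that by (simp add: active_basis_def)
  have "ip X u (mv X H u) = ip X u (\<lambda>q. 0 + (-1) * mv (E \<union> I) H u q)"
  proof (intro ip_cong)
    fix q assume "q \<in> X"
    then have "mv X H u q + mv (E \<union> I) H u q = 0" using split[of q] ker[of q] X_B by simp
    then show "mv X H u q = 0 + (-1) * mv (E \<union> I) H u q" by simp
  qed simp
  also have "\<dots> = - ip (E \<union> I) u (mv X H u)"
    unfolding ip_add_scaled_right ip_adjoint by (simp add: ip_def)
  also have "ip (E \<union> I) u (mv X H u) = 0"
    unfolding ip_def using rows by (intro sum.neutral) (auto simp: u_def)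
  finally have "ip X u (mv X H u) = 0" by simp
  moreover have "\<forall>q\<in>E. mv X H u q = 0" "\<forall>q\<in>I. mv X H z q = d q \<longrightarrow> mv X H u q = 0"
    using rows by (auto simp: active_basis_def)
  ultimately have u_X: "\<forall>q\<in>X. u q = 0"
    using sosc unfolding sosc_def by (smt (verit) less_irrefl)
  have "\<forall>q\<in>X. mv (E \<union> I) H u q = 0"
  proof
    fix q assume "q \<in> X"
    moreover have "mv X H u q = 0" unfolding mv_def using u_X by (intro sum.neutral) auto
    ultimately show "mv (E \<union> I) H u q = 0" using split[of q] ker[of q] X_B by simp
  qed
  moreover have "\<forall>q\<in>I. mv X H z q \<noteq> d q \<longrightarrow> u q = 0"
    using disj by (auto simp: u_def active_basis_def)
  ultimately have "\<forall>q\<in>E \<union> I. u q = 0" using licq by (auto simp: licq_def)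
  with u_X p have "u p = 0" by (auto simp: active_basis_def)
  with p show ?thesis by (simp add: u_def)
qed

end

section \<open>Piecewise Lipschitz paths\<close>

text \<open>Induction on the number of sets: go from \<open>a\<close> directly to the last point
  \<open>c\<close> of a set containing \<open>a\<close>. That set never recurs after
  \<open>c\<close>, so the remaining ones cover the rest. The increment \<open>\<delta>\<close>
  enters only through the triangle inequality, and the \<open>S B\<close> need not be
  intervals.\<close>

lemma piecewise_lipschitz:
  fixes \<delta> :: "real \<Rightarrow> real \<Rightarrow> real"
  assumes "finite F" and tri: "\<And>r s t. \<delta> r t \<le> \<delta> r s + \<delta> s t"
    and "a \<le> b" and closed: "\<And>B. B \<in> F \<Longrightarrow> closed (S B)"
    and "{a..b} \<subseteq> (\<Union>B\<in>F. S B)"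
    and lip: "\<And>B s t. B \<in> F \<Longrightarrow> s \<in> S B \<Longrightarrow> t \<in> S B \<Longrightarrow> a \<le> s \<Longrightarrow> s \<le> t \<Longrightarrow> t \<le> b \<Longrightarrow>
      \<delta> s t \<le> L * (t - s)"
  shows "\<delta> a b \<le> L * (b - a)"
  using assms(1,3-6)
proof (induction "card F" arbitrary: F a)
  case 0
  then show ?case by auto
next
  case (Suc n)
  obtain B where B: "B \<in> F" "a \<in> S B" using Suc.prems by (auto simp: subset_iff)
  define c where "c = Sup (S B \<inter> {a..b})"
  have cl: "closed (S B \<inter> {a..b})"
    using Suc.prems(3)[OF B(1)] by (intro closed_Int) auto
  have ne: "S B \<inter> {a..b} \<noteq> {}" using B Suc.prems by auto
  have bdd: "bdd_above (S B \<inter> {a..b})" by (auto simp: bdd_above_def)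
  have c: "c \<in> S B" "a \<le> c" "c \<le> b"
    using closed_contains_Sup[OF ne bdd cl] by (auto simp: c_def)
  have above: "t \<notin> S B" if "c < t" "t \<le> b" for t
    using cSup_upper[OF _ bdd, of t] that c by (auto simp: c_def[symmetric])
  have ac: "\<delta> a c \<le> L * (c - a)" using Suc.prems(5)[OF B(1) B(2)] c by simp
  show ?case
  proof (cases "c = b")
    case True
    then show ?thesis using ac by simp
  next
    case False
    with c have cb: "c < b" by simp
    let ?C = "\<Union>B'\<in>F - {B}. S B'"
    have "closed ?C" using Suc.prems by (intro closed_UN) auto
    moreover have "{c<..<b} \<subseteq> ?C"
    proof
      fix t assume t: "t \<in> {c<..<b}"
      then have "t \<in> {a..b}" using c by auto
      then obtain B' where "B' \<in> F" "t \<in> S B'" using Suc.prems(4) by blast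
      moreover have "t \<notin> S B" using t by (intro above) auto
      ultimately show "t \<in> ?C" by blast
    qed
    \<comment> \<open>The other sets cover only the open interval at first. Their finite union is
      closed, hence contains \<open>c\<close> too, and the induction can restart at
      \<open>c\<close>.\<close>
    ultimately have "closure {c<..<b} \<subseteq> ?C" by (simp add: closure_minimal)
    then have "{c..b} \<subseteq> ?C" using cb by simp
    moreover have "n = card (F - {B})" using Suc.hyps(2) B Suc.prems(1) by simp
    ultimately have "\<delta> c b \<le> L * (b - c)"
      using Suc.prems c by (intro Suc.hyps(1)) auto
    with ac tri[of a b c] show ?thesis by (simp add: algebra_simps)
  qed
qed

section \<open>Stacked blocks\<close>

text \<open>From every node block, the \<open>len i\<close> entries from offset \<open>off i\<close>
  on. Suitable offsets single out the primal variables and the two kinds of multipliers inside the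
  interleaved vector \<open>z\<close>.\<close>

definition seg :: "int set \<Rightarrow> (int \<Rightarrow> nat) \<Rightarrow> (int \<Rightarrow> nat) \<Rightarrow> (int \<Rightarrow> nat) \<Rightarrow> nat set" where
  "seg U s off len = {p. p < block_total U s \<and> off (block_node U s p) \<le> block_pos U s p \<and>
     block_pos U s p < off (block_node U s p) + len (block_node U s p)}"

lemma block_start_add_le:
  assumes "finite U" "i \<in> U" "i < j"
  shows "block_start U s i + s i \<le> block_start U s j"
proof -
  have "block_start U s i + s i = sum s (insert i {j. j \<in> U \<and> j < i})"
    using assms by (simp add: block_start_def)
  also have "\<dots> \<le> sum s {k. k \<in> U \<and> k < j}"
    using assms by (intro sum_mono2) auto
  finally show ?thesis by (simp add: block_start_def)
qed

lemma block_start_add_le_total: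
  assumes "finite U" "i \<in> U"
  shows "block_start U s i + s i \<le> block_total U s"
proof -
  have "block_start U s i + s i = sum s (insert i {j. j \<in> U \<and> j < i})"
    using assms by (simp add: block_start_def)
  also have "\<dots> \<le> sum s U" using assms by (intro sum_mono2) auto
  finally show ?thesis by (simp add: block_total_def)
qed

lemma block_index_less:
  "finite U \<Longrightarrow> i \<in> U \<Longrightarrow> k < s i \<Longrightarrow> block_start U s i + k < block_total U s"
  using block_start_add_le_total[of U i s] by simp

lemma block_node_index:
  assumes "finite U" "i \<in> U" "k < s i"
  shows "block_node U s (block_start U s i + k) = i"
  unfolding block_node_def
proof (rule the_equality)
  fix j assume j: "j \<in> U \<and> block_start U s j \<le> block_start U s i + k \<and>
    block_start U s i + k < block_start U s j + s j"
  show "j = i"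
  proof (rule linorder_cases[of j i])
    assume "j < i"
    with block_start_add_le[of U j i s] assms j show ?thesis by simp
  next
    assume "j > i"
    with block_start_add_le[of U i j s] assms j show ?thesis by simp
  qed
qed (use assms in auto)

lemma block_pos_index:
  assumes "finite U" "i \<in> U" "k < s i"
  shows "block_pos U s (block_start U s i + k) = k"
  using assms by (simp add: block_pos_def block_node_index)

text \<open>A counting argument: the map from (node, position) to flat index is injective into a set
  of the same finite cardinality, hence onto.\<close>

lemma block_index_cases:
  assumes U: "finite U" and p: "p < block_total U s"
  obtains i k where "i \<in> U" "k < s i" "p = block_start U s i + k"
proof -
  let ?f = "\<lambda>(i, k). block_start U s i + k" and ?S = "SIGMA i:U. {..<s i}"
  have "inj_on ?f ?S"
  proof (rule inj_onI)
    fix x y assume "x \<in> ?S" "y \<in> ?S" and eq: "?f x = ?f y"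
    then show "x = y"
      using U block_node_index[of U "fst x" "snd x" s] block_node_index[of U "fst y" "snd y" s]
        block_pos_index[of U "fst x" "snd x" s] block_pos_index[of U "fst y" "snd y" s]
      by (auto simp: split_beta)
  qed
  then have "card (?f ` ?S) = card {..<block_total U s}"
    using U by (simp add: card_image block_total_def)
  moreover have "?f ` ?S \<subseteq> {..<block_total U s}"
    using U by (auto simp: block_index_less)
  ultimately have "?f ` ?S = {..<block_total U s}" by (simp add: card_subset_eq)
  with p have "p \<in> ?f ` ?S" by simp
  then show thesis using that by auto
qed

lemma block_node_pos:
  assumes "finite U" "p < block_total U s"
  shows "block_node U s p \<in> U" "block_pos U s p < s (block_node U s p)"
    "block_start U s (block_node U s p) + block_pos U s p = p"
  using block_index_cases[OF assms] block_node_index[OF assms(1)] block_pos_index[OF assms(1)]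
  by metis+

lemma index_in_seg:
  assumes "finite U" "i \<in> U" "k < s i"
  shows "block_start U s i + k \<in> seg U s off len \<longleftrightarrow> off i \<le> k \<and> k < off i + len i"
  using assms by (simp add: seg_def block_node_index block_pos_index block_index_less)

lemma ball_seg:
  assumes U: "finite U" and le: "\<And>i. i \<in> U \<Longrightarrow> off i + len i \<le> s i"
  shows "(\<forall>p\<in>seg U s off len. P p) \<longleftrightarrow> (\<forall>i\<in>U. \<forall>k<len i. P (block_start U s i + (off i + k)))"
proof (intro iffI ballI allI impI)
  fix i k assume "\<forall>p\<in>seg U s off len. P p" "i \<in> U" "k < len i"
  then show "P (block_start U s i + (off i + k))"
    using le[of i] index_in_seg[of U i "off i + k" s off len] U by auto
next
  fix p assume *: "\<forall>i\<in>U. \<forall>k<len i. P (block_start U s i + (off i + k))" and p: "p \<in> seg U s off len"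
  let ?i = "block_node U s p" and ?k = "block_pos U s p"
  have "p < block_total U s" "off ?i \<le> ?k" "?k < off ?i + len ?i" using p by (auto simp: seg_def)
  moreover have "P (block_start U s ?i + (off ?i + (?k - off ?i)))"
    using calculation block_node_pos(1)[OF U calculation(1)] by (intro *[rule_format]) auto
  ultimately show "P p" using block_node_pos(3)[OF U, of p s] by simp
qed

lemma sum_seg:
  assumes U: "finite U" and le: "\<And>i. i \<in> U \<Longrightarrow> off i + len i \<le> s i"
  shows "sum f (seg U s off len) = (\<Sum>i\<in>U. \<Sum>k<len i. f (block_start U s i + (off i + k)))"
proof -
  let ?n = "block_node U s" and ?q = "block_pos U s"
  have "sum f (seg U s off len) = (\<Sum>(i, k)\<in>(SIGMA i:U. {..<len i}). f (block_start U s i + (off i + k)))"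
  proof (rule sum.reindex_bij_witness[where i = "\<lambda>(i, k). block_start U s i + (off i + k)"
        and j = "\<lambda>p. (?n p, ?q p - off (?n p))"])
    fix p assume "p \<in> seg U s off len"
    then have p: "p < block_total U s" "off (?n p) \<le> ?q p" "?q p < off (?n p) + len (?n p)"
      by (auto simp: seg_def)
    note np = block_node_pos[OF U p(1)]
    show eq: "(case (?n p, ?q p - off (?n p)) of (i, k) \<Rightarrow> block_start U s i + (off i + k)) = p"
      using p np by simp
    show "(?n p, ?q p - off (?n p)) \<in> (SIGMA i:U. {..<len i})" using p np by auto
    show "(case (?n p, ?q p - off (?n p)) of (i, k) \<Rightarrow> f (block_start U s i + (off i + k))) = f p"
      using eq by simp
  next
    fix x assume "x \<in> (SIGMA i:U. {..<len i})"
    then obtain i k where x: "x = (i, k)" "i \<in> U" "k < len i" by auto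
    have k: "off i + k < s i" using le[OF x(2)] x(3) by simp
    show "(\<lambda>p. (?n p, ?q p - off (?n p))) (case x of (i, k) \<Rightarrow> block_start U s i + (off i + k)) = x"
      using x k U by (simp add: block_node_index block_pos_index)
    show "(case x of (i, k) \<Rightarrow> block_start U s i + (off i + k)) \<in> seg U s off len"
      using x k U index_in_seg[of U i "off i + k" s off len] by simp
  qed
  then show ?thesis using U by (simp add: sum.Sigma)
qed

lemma seg_all: "finite U \<Longrightarrow> seg U s (\<lambda>_. 0) s = {..<block_total U s}"
  using block_node_pos(2)[of U _ s] by (auto simp: seg_def)

lemma sum_blocks:
  assumes "finite U"
  shows "sum f {..<block_total U s} = (\<Sum>i\<in>U. \<Sum>k<s i. f (block_start U s i + k))"
  using sum_seg[OF assms, of "\<lambda>_. 0" s s f] assms by (simp add: seg_all)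

lemma block_vec_index:
  "finite U \<Longrightarrow> i \<in> U \<Longrightarrow> k < s i \<Longrightarrow> block_vec U s v $ (block_start U s i + k) = v i $ k"
  by (simp add: block_vec_def block_index_less block_node_index block_pos_index)

lemma block_mat_index:
  "finite U \<Longrightarrow> i \<in> U \<Longrightarrow> j \<in> U \<Longrightarrow> k < s i \<Longrightarrow> l < t j \<Longrightarrow>
    block_mat U s t M $$ (block_start U s i + k, block_start U t j + l) = M i j $$ (k, l)"
  by (simp add: block_mat_def block_index_less block_node_index block_pos_index)

lemma block_mat_mult_index:
  assumes "finite U" "i \<in> U" "k < s i" "w \<in> carrier_vec (block_total U t)"
  shows "(block_mat U s t M *\<^sub>v w) $ (block_start U s i + k)
    = (\<Sum>j\<in>U. \<Sum>l<t j. M i j $$ (k, l) * w $ (block_start U t j + l))"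
proof -
  let ?p = "block_start U s i + k"
  have p: "?p < block_total U s" using assms by (simp add: block_index_less)
  have "(block_mat U s t M *\<^sub>v w) $ ?p = (\<Sum>q<block_total U t. block_mat U s t M $$ (?p, q) * w $ q)"
    using p assms(4) by (simp add: block_mat_def scalar_prod_def row_def atLeast0LessThan)
  also have "\<dots> = (\<Sum>j\<in>U. \<Sum>l<t j. M i j $$ (k, l) * w $ (block_start U t j + l))"
    unfolding sum_blocks[OF assms(1)] using assms by (intro sum.cong) (auto simp: block_mat_index)
  finally show ?thesis .
qed

lemma block_mat_transpose_mult_index:
  assumes "finite U" "j \<in> U" "l < t j" "w \<in> carrier_vec (block_total U s)"
  shows "((block_mat U s t M)\<^sup>T *\<^sub>v w) $ (block_start U t j + l)
    = (\<Sum>i\<in>U. \<Sum>k<s i. M i j $$ (k, l) * w $ (block_start U s i + k))"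
proof -
  let ?q = "block_start U t j + l"
  have q: "?q < block_total U t" using assms by (simp add: block_index_less)
  have "((block_mat U s t M)\<^sup>T *\<^sub>v w) $ ?q = (\<Sum>p<block_total U s. block_mat U s t M $$ (p, ?q) * w $ p)"
    using q assms(4)
    by (simp add: block_mat_def scalar_prod_def row_def atLeast0LessThan mult.commute)
  also have "\<dots> = (\<Sum>i\<in>U. \<Sum>k<s i. M i j $$ (k, l) * w $ (block_start U s i + k))"
    unfolding sum_blocks[OF assms(1)] using assms by (intro sum.cong) (auto simp: block_mat_index)
  finally show ?thesis .
qed

lemma all_blocks:
  assumes "finite U"
  shows "(\<forall>p<block_total U s. P p) \<longleftrightarrow> (\<forall>i\<in>U. \<forall>k<s i. P (block_start U s i + k))"
  using ball_seg[OF assms, of "\<lambda>_. 0" s s P] assms by (auto simp: seg_all)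

section \<open>The graph-structured program on flat indices\<close>

text \<open>Linear dependence of a set attaches coefficients to vectors; injectivity of
  \<open>row M\<close> on \<open>K\<close> carries coefficients attached to row indices over to
  it.\<close>

lemma lin_indpt_rows_zero:
  assumes indpt: "lin_indpt_rows M K" and K: "K \<subseteq> {..<dim_row M}"
    and zero: "\<And>q. q < dim_col M \<Longrightarrow> (\<Sum>p\<in>K. c p * M $$ (p, q)) = 0" and p: "p \<in> K"
  shows "c p = 0"
proof (rule ccontr)
  assume c: "c p \<noteq> 0"
  interpret vec_space "TYPE(real)" "dim_col M" .
  define a where "a v = c (inv_into K (row M) v)" for v
  have inj: "inj_on (row M) K" using indpt by (simp add: lin_indpt_rows_def)
  have a: "a (row M k) = c k" if "k \<in> K" for k using inj that by (simp add: a_def)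
  have fin: "finite K" using K finite_subset by blast
  have rows: "row M ` K \<subseteq> carrier_vec (dim_col M)" by auto
  have "lincomb a (row M ` K) = 0\<^sub>v (dim_col M)"
  proof (rule eq_vecI)
    fix q assume "q < dim_vec (0\<^sub>v (dim_col M) :: real vec)"
    then have q: "q < dim_col M" by simp
    have "lincomb a (row M ` K) $ q = (\<Sum>v\<in>row M ` K. a v * v $ q)"
      by (rule lincomb_index[OF q rows])
    also have "\<dots> = (\<Sum>k\<in>K. c k * M $$ (k, q))"
      using a q K by (subst sum.reindex[OF inj]) (auto intro!: sum.cong)
    finally show "lincomb a (row M ` K) $ q = 0\<^sub>v (dim_col M) $ q" using zero[OF q] q by simp
  next
    show "dim_vec (lincomb a (row M ` K)) = dim_vec (0\<^sub>v (dim_col M) :: real vec)"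
      by (simp add: lincomb_dim[OF finite_imageI[OF fin] rows])
  qed
  then have "lin_dep (row M ` K)"
    unfolding lin_dep_def using fin p c a[OF p]
    by (intro exI[of _ "row M ` K"] exI[of _ a] exI[of _ "row M p"]) (auto simp: module_vec_simps)
  with indpt show False by (simp add: lin_indpt_rows_def)
qed

lemma mat_diag_mult_index:
  assumes "w \<in> carrier_vec m" "p < m"
  shows "(mat_diag m f *\<^sub>v w) $ p = f p * w $ p"
  using assms
  by (simp add: mat_diag_def scalar_prod_def row_def if_distrib[of "\<lambda>x. x * _"] cong: if_cong)

section \<open>Index sets, symmetry and sparsity of the stacked KKT matrix\<close>

locale graph_problem =
  fixes G :: graph_qp and U :: "int set"
  assumes valid: "valid_graph_qp G" and sub: "U \<subseteq> nodes G" and finU: "finite U" and neU: "U \<noteq> {}"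
begin

abbreviation "n \<equiv> block_total U (ndim G)"
abbreviation "st \<equiv> block_start U (ndim G)"

definition "XI = seg U (ndim G) (\<lambda>_. 0) (rdim G)"
definition "EI = seg U (ndim G) (rdim G) (mEdim G)"
definition "II = seg U (ndim G) (\<lambda>i. rdim G i + mEdim G i) (mIdim G)"

definition Hf :: "nat \<Rightarrow> nat \<Rightarrow> real" where
  "Hf p q = Hmat G U $$ (p, q)"

lemma carriers:
  assumes "i \<in> U" "j \<in> U"
  shows "Qblk G i j \<in> carrier_mat (rdim G i) (rdim G j)"
    "AEblk G i j \<in> carrier_mat (mEdim G i) (rdim G j)"
    "AIblk G i j \<in> carrier_mat (mIdim G i) (rdim G j)"
    "Ablk G i j \<in> carrier_mat (mdim G i) (rdim G j)"
    "Hblk G i j \<in> carrier_mat (ndim G i) (ndim G j)"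
proof -
  have ij: "i \<in> nodes G" "j \<in> nodes G" using assms sub by auto
  then show 1: "Qblk G i j \<in> carrier_mat (rdim G i) (rdim G j)"
    "AEblk G i j \<in> carrier_mat (mEdim G i) (rdim G j)"
    "AIblk G i j \<in> carrier_mat (mIdim G i) (rdim G j)"
    using valid unfolding valid_graph_qp_def by blast+
  show A: "Ablk G i j \<in> carrier_mat (mdim G i) (rdim G j)"
    unfolding Ablk_def mdim_def by (rule carrier_append_rows[OF 1(2,3)])
  have "AEblk G j i \<in> carrier_mat (mEdim G j) (rdim G i)"
    "AIblk G j i \<in> carrier_mat (mIdim G j) (rdim G i)"
    using ij valid unfolding valid_graph_qp_def by blast+
  then have "Ablk G j i \<in> carrier_mat (mdim G j) (rdim G i)"
    unfolding Ablk_def mdim_def by (rule carrier_append_rows)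
  then show "Hblk G i j \<in> carrier_mat (ndim G i) (ndim G j)"
    using 1 A unfolding Hblk_def ndim_def by auto
qed

lemma Ablk_index:
  assumes "i \<in> U" "j \<in> U" "l < rdim G j"
  shows "k < mEdim G i \<Longrightarrow> Ablk G i j $$ (k, l) = AEblk G i j $$ (k, l)"
    and "k < mIdim G i \<Longrightarrow> Ablk G i j $$ (mEdim G i + k, l) = AIblk G i j $$ (k, l)"
  using carriers[OF assms(1,2)] assms(3) by (auto simp: Ablk_def append_rows_def)

lemma Hblk_index:
  assumes "i \<in> U" "j \<in> U"
  shows "k < rdim G i \<Longrightarrow> l < rdim G j \<Longrightarrow> Hblk G i j $$ (k, l) = Qblk G i j $$ (k, l)"
    and "k < rdim G i \<Longrightarrow> l < mdim G j \<Longrightarrow> Hblk G i j $$ (k, rdim G j + l) = Ablk G j i $$ (l, k)"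
    and "k < mdim G i \<Longrightarrow> l < rdim G j \<Longrightarrow> Hblk G i j $$ (rdim G i + k, l) = Ablk G i j $$ (k, l)"
    and "k < mdim G i \<Longrightarrow> l < mdim G j \<Longrightarrow> Hblk G i j $$ (rdim G i + k, rdim G j + l) = 0"
  using carriers[OF assms] carriers[OF assms(2,1)] by (auto simp: Hblk_def)

lemma Hf_index:
  "i \<in> U \<Longrightarrow> j \<in> U \<Longrightarrow> k < ndim G i \<Longrightarrow> l < ndim G j \<Longrightarrow> Hf (st i + k) (st j + l) = Hblk G i j $$ (k, l)"
  using finU by (simp add: Hf_def Hmat_def block_mat_index)

lemma Hblk_sym:
  assumes "i \<in> U" "j \<in> U" "k < ndim G i" "l < ndim G j"
  shows "Hblk G i j $$ (k, l) = Hblk G j i $$ (l, k)"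
proof -
  have Q: "Qblk G i j = (Qblk G j i)\<^sup>T"
    using valid sub assms(1,2) unfolding valid_graph_qp_def by blast
  consider "k < rdim G i" "l < rdim G j" | l' where "k < rdim G i" "l = rdim G j + l'" "l' < mdim G j"
    | k' where "l < rdim G j" "k = rdim G i + k'" "k' < mdim G i"
    | k' l' where "l = rdim G j + l'" "l' < mdim G j" "k = rdim G i + k'" "k' < mdim G i"
    using assms(3,4) unfolding ndim_def
    by (metis add_less_cancel_left le_Suc_ex not_less)
  then show ?thesis
  proof cases
    case 1
    then show ?thesis
      using Q carriers(1)[OF assms(2,1)] Hblk_index(1)[OF assms(1,2)] Hblk_index(1)[OF assms(2,1)] by simp
  next
    case (2 l')
    then show ?thesis using Hblk_index(2)[OF assms(1,2)] Hblk_index(3)[OF assms(2,1)] by simp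
  next
    case (3 k')
    then show ?thesis using Hblk_index(3)[OF assms(1,2)] Hblk_index(2)[OF assms(2,1)] by simp
  next
    case (4 k' l')
    then show ?thesis using Hblk_index(4)[OF assms(1,2)] Hblk_index(4)[OF assms(2,1)] by simp
  qed
qed

lemma Hf_sym:
  assumes "p < n" "q < n"
  shows "Hf p q = Hf q p"
proof -
  obtain i k where i: "i \<in> U" "k < ndim G i" "p = st i + k"
    using block_index_cases[OF finU assms(1)] by blast
  obtain j l where j: "j \<in> U" "l < ndim G j" "q = st j + l"
    using block_index_cases[OF finU assms(2)] by blast
  show ?thesis using i j by (simp add: Hf_index Hblk_sym[of i j k l])
qed

lemma Hblk_zero:
  assumes "i \<in> U" "j \<in> U" "i \<noteq> j" "{i, j} \<notin> edges G" "k < ndim G i" "l < ndim G j"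
  shows "Hblk G i j $$ (k, l) = 0"
proof -
  \<comment> \<open>\<open>Hblk G i j\<close> also contains the transpose of
    \<open>Ablk G j i\<close>, so the reversed pair must be seen to be non-adjacent.\<close>
  have ij: "i \<in> nodes G" "j \<in> nodes G" "{j, i} \<notin> edges G"
    using assms sub by (auto simp: insert_commute)
  have z: "Qblk G i j = 0\<^sub>m (rdim G i) (rdim G j)" "AEblk G i j = 0\<^sub>m (mEdim G i) (rdim G j)"
    "AIblk G i j = 0\<^sub>m (mIdim G i) (rdim G j)" "AEblk G j i = 0\<^sub>m (mEdim G j) (rdim G i)"
    "AIblk G j i = 0\<^sub>m (mIdim G j) (rdim G i)"
    using valid ij assms(3,4) unfolding valid_graph_qp_def by metis+
  show ?thesis
    using assms(5,6) z by (auto simp: Hblk_def Ablk_def append_rows_def ndim_def mdim_def)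
qed

lemma seg_le:
  "rdim G i \<le> ndim G i" "rdim G i + mEdim G i \<le> ndim G i"
  "rdim G i + mEdim G i + mIdim G i \<le> ndim G i" "rdim G i + mdim G i \<le> ndim G i"
  by (simp_all add: ndim_def mdim_def)

lemma EI_II: "EI \<union> II = seg U (ndim G) (rdim G) (mdim G)"
  by (auto simp: EI_def II_def seg_def mdim_def)

lemma partition: "XI \<union> EI \<union> II = {..<n}"
  using block_node_pos(2)[OF finU, of _ "ndim G"]
  by (auto simp: XI_def EI_def II_def seg_def ndim_def mdim_def add.assoc)

lemma mult_X_row:
  assumes "i \<in> U" "k < ndim G i"
  shows "mv XI Hf v (st i + k) = (\<Sum>j\<in>U. \<Sum>l<rdim G j. Hblk G i j $$ (k, l) * v (st j + l))"
  unfolding mv_def XI_def using assms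
  by (subst sum_seg[OF finU]) (auto simp: Hf_index seg_le ndim_def intro!: sum.cong)

lemma mult_L_row:
  assumes "i \<in> U" "k < ndim G i"
  shows "mv (EI \<union> II) Hf v (st i + k)
    = (\<Sum>j\<in>U. \<Sum>l<mdim G j. Hblk G i j $$ (k, rdim G j + l) * v (st j + (rdim G j + l)))"
  unfolding mv_def EI_II using assms
  by (subst sum_seg[OF finU]) (auto simp: Hf_index seg_le ndim_def intro!: sum.cong)

sublocale kkt_system XI EI II Hf
proof
  show "finite XI" "finite EI" "finite II" by (auto simp: XI_def EI_def II_def seg_def)
  show "XI \<inter> EI = {}" "XI \<inter> II = {}" "EI \<inter> II = {}" by (auto simp: XI_def EI_def II_def seg_def)
  show "\<forall>p\<in>XI \<union> EI \<union> II. \<forall>q\<in>XI \<union> EI \<union> II. Hf p q = Hf q p"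
    unfolding partition using Hf_sym by auto
  show "\<forall>p\<in>EI \<union> II. \<forall>q\<in>EI \<union> II. Hf p q = 0"
    unfolding EI_II
    by (auto simp: ball_seg[OF finU] seg_le Hf_index ndim_def Hblk_index)
qed

text \<open>A relation rather than a map, since \<open>v\<close> matters only on the primal indices.
  It covers both the primal part of a given \<open>z\<close> and an arbitrary direction in the
  critical cone.\<close>

definition x_rep :: "real vec \<Rightarrow> (nat \<Rightarrow> real) \<Rightarrow> bool" where
  "x_rep w v \<longleftrightarrow> w \<in> carrier_vec (block_total U (rdim G)) \<and>
     (\<forall>i\<in>U. \<forall>k<rdim G i. w $ (block_start U (rdim G) i + k) = v (st i + k))"

definition l_rep :: "real vec \<Rightarrow> (nat \<Rightarrow> real) \<Rightarrow> bool" where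
  "l_rep w v \<longleftrightarrow> w \<in> carrier_vec (block_total U (mdim G)) \<and>
     (\<forall>i\<in>U. \<forall>k<mdim G i. w $ (block_start U (mdim G) i + k) = v (st i + (rdim G i + k)))"

lemma Q_mult:
  assumes "x_rep w v" "i \<in> U" "k < rdim G i"
  shows "(Qmat G U *\<^sub>v w) $ (block_start U (rdim G) i + k) = mv XI Hf v (st i + k)"
  using assms unfolding Qmat_def x_rep_def
  by (auto simp: block_mat_mult_index[OF finU] mult_X_row ndim_def Hblk_index intro!: sum.cong)

lemma A_mult:
  assumes "x_rep w v" "i \<in> U" "k < mdim G i"
  shows "(Amat G U *\<^sub>v w) $ (block_start U (mdim G) i + k) = mv XI Hf v (st i + (rdim G i + k))"
  using assms unfolding Amat_def x_rep_def
  by (auto simp: block_mat_mult_index[OF finU] mult_X_row ndim_def Hblk_index intro!: sum.cong)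

lemma AE_mult:
  assumes "x_rep w v" "i \<in> U" "k < mEdim G i"
  shows "(AEmat G U *\<^sub>v w) $ (block_start U (mEdim G) i + k) = mv XI Hf v (st i + (rdim G i + k))"
  using assms unfolding AEmat_def x_rep_def
  by (auto simp: block_mat_mult_index[OF finU] mult_X_row ndim_def mdim_def Hblk_index Ablk_index
      intro!: sum.cong)

lemma AI_mult:
  assumes "x_rep w v" "i \<in> U" "k < mIdim G i"
  shows "(AImat G U *\<^sub>v w) $ (block_start U (mIdim G) i + k)
    = mv XI Hf v (st i + (rdim G i + mEdim G i + k))"
  using assms unfolding AImat_def x_rep_def
  by (auto simp: block_mat_mult_index[OF finU] mult_X_row ndim_def mdim_def Hblk_index Ablk_index
      add.assoc intro!: sum.cong)

lemma AT_mult: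
  assumes "l_rep w v" "i \<in> U" "k < rdim G i"
  shows "((Amat G U)\<^sup>T *\<^sub>v w) $ (block_start U (rdim G) i + k) = mv (EI \<union> II) Hf v (st i + k)"
  using assms unfolding Amat_def l_rep_def
  by (auto simp: block_mat_transpose_mult_index[OF finU] mult_L_row ndim_def Hblk_index
      intro!: sum.cong)

lemma parts_carrier:
  "x_part G U z \<in> carrier_vec (block_total U (rdim G))"
  "l_part G U z \<in> carrier_vec (block_total U (mdim G))"
  "lE_part G U z \<in> carrier_vec (block_total U (mEdim G))"
  "lI_part G U z \<in> carrier_vec (block_total U (mIdim G))"
  by (simp_all add: x_part_def l_part_def lE_part_def lI_part_def block_vec_def)

lemma Tblk_index: "k < ndim G i \<Longrightarrow> Tblk G U i z $ k = z $ (st i + k)"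
  by (simp add: Tblk_def extract_block_def)

lemma dim_Tblk [simp]: "dim_vec (Tblk G U i z) = ndim G i"
  by (simp add: Tblk_def extract_block_def)

lemma parts_index:
  assumes "i \<in> U"
  shows "k < rdim G i \<Longrightarrow> x_part G U z $ (block_start U (rdim G) i + k) = z $ (st i + k)"
    and "k < mdim G i \<Longrightarrow> l_part G U z $ (block_start U (mdim G) i + k) = z $ (st i + (rdim G i + k))"
    and "k < mEdim G i \<Longrightarrow> lE_part G U z $ (block_start U (mEdim G) i + k) = z $ (st i + (rdim G i + k))"
    and "k < mIdim G i \<Longrightarrow>
      lI_part G U z $ (block_start U (mIdim G) i + k) = z $ (st i + (rdim G i + mEdim G i + k))"
  using assms finU
  by (simp_all add: x_part_def l_part_def lE_part_def lI_part_def block_vec_index vec_first_def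
      vec_last_def Tblk_index ndim_def mdim_def add.assoc)

lemma x_rep_part: "x_rep (x_part G U z) (($) z)"
  by (simp add: x_rep_def parts_carrier parts_index)

lemma l_rep_part: "l_rep (l_part G U z) (($) z)"
  by (simp add: l_rep_def parts_carrier parts_index)

lemma vec_eq_blocks:
  assumes "v \<in> carrier_vec (block_total U s)" "w \<in> carrier_vec (block_total U s)"
  shows "v = w \<longleftrightarrow> (\<forall>i\<in>U. \<forall>k<s i. v $ (block_start U s i + k) = w $ (block_start U s i + k))"
  using assms all_blocks[OF finU, of s "\<lambda>p. v $ p = w $ p"] by (auto simp: vec_eq_iff)

lemma vec_le_blocks:
  assumes "v \<in> carrier_vec (block_total U s)" "w \<in> carrier_vec (block_total U s)"
  shows "v \<le> w \<longleftrightarrow> (\<forall>i\<in>U. \<forall>k<s i. v $ (block_start U s i + k) \<le> w $ (block_start U s i + k))"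
  using assms all_blocks[OF finU, of s "\<lambda>p. v $ p \<le> w $ p"] by (auto simp: less_eq_vec_def)

lemma mat_carriers:
  "Qmat G U \<in> carrier_mat (block_total U (rdim G)) (block_total U (rdim G))"
  "Amat G U \<in> carrier_mat (block_total U (mdim G)) (block_total U (rdim G))"
  "AEmat G U \<in> carrier_mat (block_total U (mEdim G)) (block_total U (rdim G))"
  "AImat G U \<in> carrier_mat (block_total U (mIdim G)) (block_total U (rdim G))"
  "Hmat G U \<in> carrier_mat n n"
  by (simp_all add: Qmat_def Amat_def AEmat_def AImat_def Hmat_def block_mat_def)

lemma ball_XI: "(\<forall>p\<in>XI. P p) \<longleftrightarrow> (\<forall>i\<in>U. \<forall>k<rdim G i. P (st i + k))"
  unfolding XI_def by (subst ball_seg[OF finU]) (auto simp: seg_le)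

lemma ball_EI: "(\<forall>p\<in>EI. P p) \<longleftrightarrow> (\<forall>i\<in>U. \<forall>k<mEdim G i. P (st i + (rdim G i + k)))"
  unfolding EI_def by (subst ball_seg[OF finU]) (auto simp: seg_le)

lemma ball_II: "(\<forall>p\<in>II. P p) \<longleftrightarrow> (\<forall>i\<in>U. \<forall>k<mIdim G i. P (st i + (rdim G i + mEdim G i + k)))"
  unfolding II_def by (subst ball_seg[OF finU]) (auto simp: seg_le)

lemma ball_L: "(\<forall>p\<in>EI \<union> II. P p) \<longleftrightarrow> (\<forall>i\<in>U. \<forall>k<mdim G i. P (st i + (rdim G i + k)))"
  unfolding EI_II by (subst ball_seg[OF finU]) (auto simp: seg_le)

section \<open>Optimality and regularity conditions in flat form\<close>

lemma primal_dual_solution_iff_kkt: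
  "primal_dual_solution G U d z \<longleftrightarrow> z \<in> carrier_vec n \<and> kkt (($) d) (($) z)"
proof -
  let ?x = "x_part G U z" and ?l = "l_part G U z"
  have 1: "Qmat G U *\<^sub>v ?x + (Amat G U)\<^sup>T *\<^sub>v ?l = x_part G U d \<longleftrightarrow>
    (\<forall>p\<in>XI. mv XI Hf (($) z) p + mv (EI \<union> II) Hf (($) z) p = d $ p)"
    using mat_carriers
    by (subst vec_eq_blocks[where s = "rdim G"])
      (auto simp: parts_carrier parts_index ball_XI Q_mult[OF x_rep_part] AT_mult[OF l_rep_part]
        block_index_less[OF finU] simp del: index_mult_mat_vec)
  have 2: "AEmat G U *\<^sub>v ?x = lE_part G U d \<longleftrightarrow> (\<forall>p\<in>EI. mv XI Hf (($) z) p = d $ p)"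
    using mat_carriers
    by (subst vec_eq_blocks[where s = "mEdim G"])
      (auto simp: parts_carrier parts_index ball_EI AE_mult[OF x_rep_part] simp del: index_mult_mat_vec)
  have 3: "lI_part G U d \<le> AImat G U *\<^sub>v ?x \<longleftrightarrow> (\<forall>p\<in>II. d $ p \<le> mv XI Hf (($) z) p)"
    using mat_carriers
    by (subst vec_le_blocks[where s = "mIdim G"])
      (auto simp: parts_carrier parts_index ball_II AI_mult[OF x_rep_part] simp del: index_mult_mat_vec)
  have 4: "lI_part G U z \<le> 0\<^sub>v (block_total U (mIdim G)) \<longleftrightarrow> (\<forall>p\<in>II. z $ p \<le> 0)"
    by (subst vec_le_blocks[where s = "mIdim G"])
      (auto simp: parts_carrier parts_index ball_II block_index_less[OF finU])
  have c: "AImat G U *\<^sub>v ?x - lI_part G U d \<in> carrier_vec (block_total U (mIdim G))"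
    using mat_carriers parts_carrier by auto
  have c2: "mat_diag (block_total U (mIdim G)) (($) (lI_part G U z)) *\<^sub>v
       (AImat G U *\<^sub>v ?x - lI_part G U d) \<in> carrier_vec (block_total U (mIdim G))"
    by (rule carrier_vecI) (simp add: mat_diag_def)
  have 5: "mat_diag (block_total U (mIdim G)) (($) (lI_part G U z)) *\<^sub>v
       (AImat G U *\<^sub>v ?x - lI_part G U d) = 0\<^sub>v (block_total U (mIdim G)) \<longleftrightarrow>
    (\<forall>p\<in>II. z $ p * (mv XI Hf (($) z) p - d $ p) = 0)"
    using mat_carriers(4) carrier_vecD[OF parts_carrier(4)]
    unfolding vec_eq_blocks[OF c2 zero_carrier_vec]
    by (auto simp: parts_index ball_II mat_diag_mult_index[OF c] block_index_less[OF finU]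
        AI_mult[OF x_rep_part] simp del: mult_eq_0_iff index_mult_mat_vec)
  show ?thesis
    unfolding primal_dual_solution_def kkt_def 1 2 3 4 5 by blast
qed

lemma x_rep_exists: obtains w where "x_rep w v"
proof
  show "x_rep (block_vec U (rdim G) (\<lambda>i. vec (rdim G i) (\<lambda>k. v (st i + k)))) v"
    using finU by (simp add: x_rep_def block_vec_index) (simp add: block_vec_def)
qed

lemma l_rep_exists: obtains w where "l_rep w v"
proof
  show "l_rep (block_vec U (mdim G) (\<lambda>i. vec (mdim G i) (\<lambda>k. v (st i + (rdim G i + k))))) v"
    using finU by (simp add: l_rep_def block_vec_index) (simp add: block_vec_def)
qed

lemma Q_form:
  assumes w: "x_rep w v"
  shows "w \<bullet> (Qmat G U *\<^sub>v w) = ip XI v (mv XI Hf v)"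
proof -
  have "w \<bullet> (Qmat G U *\<^sub>v w) = (\<Sum>p<block_total U (rdim G). w $ p * (Qmat G U *\<^sub>v w) $ p)"
    using mat_carriers(1) by (auto simp: scalar_prod_def atLeast0LessThan)
  also have "\<dots> = (\<Sum>i\<in>U. \<Sum>k<rdim G i. v (st i + k) * mv XI Hf v (st i + k))"
    unfolding sum_blocks[OF finU] using w
    by (auto simp: Q_mult[OF w] x_rep_def simp del: index_mult_mat_vec intro!: sum.cong)
  also have "\<dots> = ip XI v (mv XI Hf v)"
    unfolding ip_def XI_def by (subst sum_seg[OF finU]) (auto simp: seg_le)
  finally show ?thesis .
qed

lemma pos_semidef_imp:
  assumes "pos_semidef (Qmat G U)"
  shows "0 \<le> ip XI v (mv XI Hf v)"
proof -
  obtain w where w: "x_rep w v" by (rule x_rep_exists)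
  then have "0 \<le> w \<bullet> (Qmat G U *\<^sub>v w)"
    using assms mat_carriers(1) by (auto simp: pos_semidef_def x_rep_def)
  then show ?thesis by (simp only: Q_form[OF w])
qed

lemma SOSC_imp_sosc:
  assumes "SOSC G U d z"
  shows "sosc (($) d) (($) z)"
  unfolding sosc_def
proof (intro allI impI)
  fix v assume E: "\<forall>p\<in>EI. mv XI Hf v p = 0"
    and I: "\<forall>p\<in>II. mv XI Hf (($) z) p = d $ p \<longrightarrow>
      (if z $ p < 0 then mv XI Hf v p = 0 else 0 \<le> mv XI Hf v p)"
    and X: "\<exists>p\<in>XI. v p \<noteq> 0"
  obtain w where w: "x_rep w v" by (rule x_rep_exists)
  have w_carrier: "w \<in> carrier_vec (block_total U (rdim G))" using w by (simp add: x_rep_def)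
  have "AEmat G U *\<^sub>v w = 0\<^sub>v (block_total U (mEdim G))"
    using E mult_mat_vec_carrier[OF mat_carriers(3) w_carrier]
    by (subst vec_eq_blocks[where s = "mEdim G"])
      (auto simp: ball_EI AE_mult[OF w] block_index_less[OF finU] simp del: index_mult_mat_vec)
  moreover have "\<forall>k < block_total U (mIdim G).
      (AImat G U *\<^sub>v x_part G U z) $ k = lI_part G U d $ k \<longrightarrow>
        (if lI_part G U z $ k < 0 then (AImat G U *\<^sub>v w) $ k = 0 else 0 \<le> (AImat G U *\<^sub>v w) $ k)"
    using I unfolding all_blocks[OF finU] ball_II
    by (simp add: AI_mult[OF w] AI_mult[OF x_rep_part] parts_index del: index_mult_mat_vec)
  ultimately have "w \<in> critical_cone G U d z" using w_carrier by (simp add: critical_cone_def)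
  moreover have "w \<noteq> 0\<^sub>v (block_total U (rdim G))"
  proof
    assume 0: "w = 0\<^sub>v (block_total U (rdim G))"
    have "\<forall>p\<in>XI. v p = 0"
      unfolding ball_XI using w by (auto simp: x_rep_def 0 block_index_less[OF finU])
    with X show False by auto
  qed
  ultimately have "0 < w \<bullet> (Qmat G U *\<^sub>v w)" using assms by (auto simp: SOSC_def)
  then show "0 < ip XI v (mv XI Hf v)" by (simp only: Q_form[OF w])
qed

lemma LICQ_imp_licq:
  assumes "LICQ G U d z"
  shows "licq (($) d) (($) z)"
  unfolding licq_def
proof (intro allI impI)
  fix \<mu> assume X: "\<forall>p\<in>XI. mv (EI \<union> II) Hf \<mu> p = 0"
    and I: "\<forall>p\<in>II. mv XI Hf (($) z) p \<noteq> d $ p \<longrightarrow> \<mu> p = 0"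
  let ?K = "active_rows G U d z" and ?A = "Amat G U" and ?m = "block_total U (mdim G)"
  obtain w where w: "l_rep w \<mu>" by (rule l_rep_exists)
  have w_carrier: "w \<in> carrier_vec ?m" using w by (simp add: l_rep_def)
  have K: "?K \<subseteq> {..<?m}" by (auto simp: active_rows_def)
  \<comment> \<open>Equality rows always count as active, so a row outside \<open>?K\<close> belongs
    to an inequality that is strict at \<open>z\<close>, and the assumption on \<open>\<mu>\<close>
    applies. The sum over the active rows is therefore the full product with the transpose.\<close>
  have out: "w $ p = 0" if p: "p < ?m" "p \<notin> ?K" for p
  proof -
    obtain i k where ik: "i \<in> U" "k < mdim G i" "p = block_start U (mdim G) i + k"
      using block_index_cases[OF finU p(1)] by blast
    with p have not: "\<not> k < mEdim G i" "(?A *\<^sub>v x_part G U z) $ p \<noteq> l_part G U d $ p"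
      by (auto simp: active_rows_def block_node_index[OF finU] block_pos_index[OF finU])
    define l where "l = k - mEdim G i"
    have l: "k = mEdim G i + l" "l < mIdim G i" using not(1) ik(2) by (auto simp: l_def mdim_def)
    let ?p = "st i + (rdim G i + k)"
    have "?p \<in> II"
      unfolding II_def using ik l
      by (subst index_in_seg[OF finU]) (auto simp: ndim_def mdim_def)
    moreover have "mv XI Hf (($) z) ?p \<noteq> d $ ?p"
      using not(2) ik by (simp add: A_mult[OF x_rep_part] parts_index del: index_mult_mat_vec)
    ultimately have "\<mu> ?p = 0" using I by blast
    then show ?thesis using w ik by (simp add: l_rep_def)
  qed
  have "w $ p = 0" if "p \<in> ?K" for p
  proof (rule lin_indpt_rows_zero)
    show "lin_indpt_rows ?A ?K" using assms by (simp add: LICQ_def)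
    show "?K \<subseteq> {..<dim_row ?A}" using K mat_carriers(2) by simp
    show "p \<in> ?K" by (rule that)
    fix q assume "q < dim_col ?A"
    then have q: "q < block_total U (rdim G)" using mat_carriers(2) by simp
    have "(\<Sum>p\<in>?K. w $ p * ?A $$ (p, q)) = (\<Sum>p<?m. w $ p * ?A $$ (p, q))"
      using K out by (intro sum.mono_neutral_left) auto
    also have "\<dots> = (?A\<^sup>T *\<^sub>v w) $ q"
      using q w_carrier mat_carriers(2)
      by (auto simp: scalar_prod_def atLeast0LessThan mult.commute intro!: sum.cong)
    also have "\<dots> = 0"
    proof -
      obtain i k where ik: "i \<in> U" "k < rdim G i" "q = block_start U (rdim G) i + k"
        using block_index_cases[OF finU q] by blast
      then show ?thesis
        using X by (simp add: AT_mult[OF w] ball_XI del: index_mult_mat_vec)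
    qed
    finally show "(\<Sum>p\<in>?K. w $ p * ?A $$ (p, q)) = 0" .
  qed
  with out have w0: "w $ p = 0" if "p < ?m" for p using that by blast
  show "\<forall>p\<in>EI \<union> II. \<mu> p = 0"
    unfolding ball_L using w w0 by (auto simp: l_rep_def block_index_less[OF finU])
qed

end

section \<open>Bases and basic solutions\<close>

lemma bij_betw_pick:
  assumes "finite B"
  shows "bij_betw (pick B) {..<card B} B"
proof -
  have inj: "inj_on (pick B) {..<card B}"
    using pick_mono_le[of _ B] by (auto simp: inj_on_def) (metis less_irrefl linorder_neqE_nat)
  have "pick B ` {..<card B} \<subseteq> B" using pick_in_set_le by auto
  then have "pick B ` {..<card B} = B"
    using assms by (intro card_subset_eq) (auto simp: card_image[OF inj])
  with inj show ?thesis by (simp add: bij_betw_def)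
qed

lemma invertible_mat_iff_mat_op:
  fixes M :: "real mat"
  assumes M: "M \<in> carrier_mat k k"
  shows "invertible_mat M \<longleftrightarrow> (\<forall>v. (\<forall>p<k. mat_op M v p = 0) \<longrightarrow> (\<forall>p<k. v p = 0))" (is "?l \<longleftrightarrow> ?r")
    and "invertible_mat M \<Longrightarrow> \<exists>v. \<forall>p<k. mat_op M v p = e p"
proof -
  have inv: "\<exists>C \<in> carrier_mat k k. C * M = 1\<^sub>m k \<and> M * C = 1\<^sub>m k" if l: ?l
  proof -
    obtain C where C: "M * C = 1\<^sub>m k" "C * M = 1\<^sub>m (dim_row C)"
      using l M by (auto simp: invertible_mat_def inverts_mat_def)
    \<comment> \<open>\<open>invertible_mat\<close> leaves the shape of the inverse open; it is
      recovered from the shapes of the two identity matrices.\<close>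
    have "dim_col C = k" using arg_cong[OF C(1), of dim_col] by simp
    moreover have "dim_row C = k" using arg_cong[OF C(2), of dim_col] M by simp
    ultimately show ?thesis using C by auto
  qed
  show "?l \<longleftrightarrow> ?r"
  proof (intro iffI allI impI)
    fix v p assume l: ?l and v: "\<forall>p<k. mat_op M v p = 0" and p: "p < k"
    from inv[OF l] obtain C where C: "C \<in> carrier_mat k k" "C * M = 1\<^sub>m k" by blast
    have "v p = mat_op C (mat_op M v) p"
      using mat_op_mult[OF C(1) M p, of v] p by (simp only: C(2) mat_op_one)
    also have "\<dots> = 0" using v C(1) unfolding mv_def[of "{..<dim_col C}"]
      by (intro sum.neutral) auto
    finally show "v p = 0" .
  next
    assume r: ?r
    have "det M \<noteq> 0"
    proof
      assume "det M = 0"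
      then obtain v where v: "v \<in> carrier_vec k" "v \<noteq> 0\<^sub>v k" "M *\<^sub>v v = 0\<^sub>v k"
        using det_0_iff_vec_prod_zero_field[OF M] by blast
      have "mat_op M (($) v) p = 0" if "p < k" for p
        using mult_mat_vec_eq_mat_op[of v M p] v M that by simp
      with r have "\<forall>p<k. v $ p = 0" by blast
      with v show False by auto
    qed
    from det_non_zero_imp_unit[OF M this, of "()"]
    obtain C where "C \<in> carrier_mat k k" "C * M = 1\<^sub>m k" "M * C = 1\<^sub>m k"
      unfolding Units_def ring_mat_def by auto
    then show ?l
      using M unfolding invertible_mat_def inverts_mat_def by (intro conjI exI[of _ C]) auto
  qed
  assume ?l
  from inv[OF this] obtain C where C: "C \<in> carrier_mat k k" "M * C = 1\<^sub>m k" by blast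
  have "mat_op M (mat_op C e) p = e p" if "p < k" for p
    using mat_op_mult[OF M C(1) that, of e] that by (simp only: C(2) mat_op_one)
  then show "\<exists>v. \<forall>p<k. mat_op M v p = e p" by blast
qed

context graph_problem
begin

context
  fixes B :: "nat set"
  assumes B: "B \<subseteq> {..<n}"
begin

lemma finite_B: "finite B"
  using B finite_subset by blast

lemma B_restrict: "{p. p < n \<and> p \<in> B} = B"
  using B by auto

lemma sub_carrier: "submatrix (Hmat G U) B B \<in> carrier_mat (card B) (card B)"
  using mat_carriers(5) by (auto simp: dim_submatrix B_restrict)

text \<open>\<open>pick B\<close> is the increasing enumeration behind \<open>submatrix\<close>.
  Reindexing along it lets every later argument about \<open>H[B,B]\<close> be carried out on
  \<open>B\<close> itself.\<close>

lemma sub_op: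
  assumes "p < card B"
  shows "mat_op (submatrix (Hmat G U) B B) (\<lambda>l. v (pick B l)) p = mv B Hf v (pick B p)"
proof -
  have "mat_op (submatrix (Hmat G U) B B) (\<lambda>l. v (pick B l)) p
      = (\<Sum>l<card B. Hf (pick B p) (pick B l) * v (pick B l))"
    using assms sub_carrier mat_carriers(5) unfolding mv_def
    by (intro sum.cong) (auto simp: submatrix_index B_restrict Hf_def)
  also have "\<dots> = mv B Hf v (pick B p)"
    unfolding mv_def by (rule sum.reindex_bij_betw[OF bij_betw_pick[OF finite_B]])
  finally show ?thesis .
qed

lemma ip_pick: "ip {..<card B} (\<lambda>l. u (pick B l)) (\<lambda>l. v (pick B l)) = ip B u v"
  unfolding ip_def by (rule sum.reindex_bij_betw[OF bij_betw_pick[OF finite_B]])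

lemma all_pick: "(\<forall>l<card B. P (pick B l)) \<longleftrightarrow> (\<forall>p\<in>B. P p)"
proof -
  have "pick B ` {..<card B} = B" using bij_betw_pick[OF finite_B] by (simp add: bij_betw_def)
  moreover have "(\<forall>l<card B. P (pick B l)) \<longleftrightarrow> (\<forall>p\<in>pick B ` {..<card B}. P p)" by auto
  ultimately show ?thesis by simp
qed

lemma unpick: obtains v where "\<And>l. l < card B \<Longrightarrow> v (pick B l) = u l"
proof
  fix l assume "l < card B"
  then show "u (inv_into {..<card B} (pick B) (pick B l)) = u l"
    using bij_betw_pick[OF finite_B] by (simp add: bij_betw_def)
qed

lemma is_basis_iff:
  "is_basis G U B \<longleftrightarrow> B \<noteq> {} \<and> (\<forall>v. (\<forall>p\<in>B. mv B Hf v p = 0) \<longrightarrow> (\<forall>p\<in>B. v p = 0))"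
proof -
  let ?M = "submatrix (Hmat G U) B B"
  have "(\<forall>u. (\<forall>p<card B. mat_op ?M u p = 0) \<longrightarrow> (\<forall>p<card B. u p = 0)) \<longleftrightarrow>
    (\<forall>v. (\<forall>p\<in>B. mv B Hf v p = 0) \<longrightarrow> (\<forall>p\<in>B. v p = 0))" (is "?l \<longleftrightarrow> ?r")
  proof
    assume l: ?l
    show ?r
    proof (intro allI impI)
      fix v assume "\<forall>p\<in>B. mv B Hf v p = 0"
      then have "\<forall>p<card B. mat_op ?M (\<lambda>l. v (pick B l)) p = 0"
        using sub_op all_pick[of "\<lambda>p. mv B Hf v p = 0"] by simp
      then have "\<forall>p<card B. v (pick B p) = 0" using l by blast
      then show "\<forall>p\<in>B. v p = 0" by (simp only: all_pick[of "\<lambda>p. v p = 0"])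
    qed
  next
    assume r: ?r
    show ?l
    proof (intro allI impI)
      fix u p assume u: "\<forall>p<card B. mat_op ?M u p = 0" and p: "p < card B"
      obtain v where v: "\<And>l. l < card B \<Longrightarrow> v (pick B l) = u l" using unpick[of u] by blast
      have "mat_op ?M u l = mv B Hf v (pick B l)" if "l < card B" for l
        unfolding sub_op[OF that, symmetric] using v sub_carrier by (intro mv_cong) auto
      with u have "\<forall>l<card B. mv B Hf v (pick B l) = 0" by simp
      then have "\<forall>p\<in>B. mv B Hf v p = 0" by (simp only: all_pick[of "\<lambda>p. mv B Hf v p = 0"])
      with r have "\<forall>p\<in>B. v p = 0" by blast
      then show "u p = 0" using v[OF p] all_pick[of "\<lambda>p. v p = 0"] p by simp
    qed
  qed
  then show ?thesis
    unfolding is_basis_def invertible_mat_iff_mat_op(1)[OF sub_carrier] using B by simp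
qed

lemma basis_solvable:
  assumes "is_basis G U B"
  shows "\<exists>y. \<forall>p\<in>B. mv B Hf y p = e p"
proof -
  let ?M = "submatrix (Hmat G U) B B"
  have "invertible_mat ?M" using assms by (simp add: is_basis_def)
  from invertible_mat_iff_mat_op(2)[OF sub_carrier this, of "\<lambda>l. e (pick B l)"]
  obtain u where u: "\<forall>p<card B. mat_op ?M u p = e (pick B p)" by blast
  obtain v where v: "\<And>l. l < card B \<Longrightarrow> v (pick B l) = u l" using unpick[of u] by blast
  have "mat_op ?M u l = mv B Hf v (pick B l)" if "l < card B" for l
    unfolding sub_op[OF that, symmetric] using v sub_carrier by (intro mv_cong) auto
  with u have "\<forall>l<card B. mv B Hf v (pick B l) = e (pick B l)" by simp
  then have "\<forall>p\<in>B. mv B Hf v p = e p" by (simp only: all_pick[of "\<lambda>p. mv B Hf v p = e p"])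
  then show ?thesis by (intro exI[of _ v])
qed

lemma basis_kernel:
  "is_basis G U B \<Longrightarrow> (\<And>p. p \<in> B \<Longrightarrow> mv B Hf v p = 0) \<Longrightarrow> p \<in> B \<Longrightarrow> v p = 0"
  using is_basis_iff by blast

lemma sub_eq_iff:
  assumes "z \<in> carrier_vec n" "d \<in> carrier_vec n"
  shows "submatrix (Hmat G U) B B *\<^sub>v subvec z B = subvec d B \<longleftrightarrow>
    (\<forall>p\<in>B. mv B Hf (($) z) p = d $ p)"
proof -
  let ?M = "submatrix (Hmat G U) B B"
  have sv: "subvec v B = vec (card B) (\<lambda>l. v $ pick B l)" if "v \<in> carrier_vec n" for v :: "real vec"
    using that by (simp add: subvec_def B_restrict)
  have "(?M *\<^sub>v subvec z B) $ p = mv B Hf (($) z) (pick B p)" if p: "p < card B" for p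
  proof -
    have "(?M *\<^sub>v subvec z B) $ p = mat_op ?M (($) (subvec z B)) p"
      using p sub_carrier assms by (intro mult_mat_vec_eq_mat_op) (auto simp: sv)
    also have "\<dots> = mat_op ?M (\<lambda>l. z $ pick B l) p"
      using sub_carrier assms by (intro mv_cong) (auto simp: sv)
    finally show ?thesis by (simp only: sub_op[OF p])
  qed
  then have "?M *\<^sub>v subvec z B = subvec d B \<longleftrightarrow>
      (\<forall>p<card B. mv B Hf (($) z) (pick B p) = d $ pick B p)"
    using sub_carrier assms by (auto simp: vec_eq_iff sv simp del: index_mult_mat_vec)
  then show ?thesis by (simp only: all_pick[of "\<lambda>p. mv B Hf (($) z) p = d $ p"])
qed

lemma basic_solution_eqI:
  assumes basis: "is_basis G U B" and d: "d \<in> carrier_vec n" and z: "z \<in> carrier_vec n"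
    and eq: "\<And>p. p \<in> B \<Longrightarrow> mv B Hf (($) z) p = d $ p"
    and out: "\<And>p. p < n \<Longrightarrow> p \<notin> B \<Longrightarrow> z $ p = 0"
  shows "basic_solution G U B d = z"
  unfolding basic_solution_def
proof (rule the_equality)
  show "z \<in> carrier_vec n \<and> submatrix (Hmat G U) B B *\<^sub>v subvec z B = subvec d B \<and>
    (\<forall>p<n. p \<notin> B \<longrightarrow> z $ p = 0)"
    using sub_eq_iff[OF z d] z eq out by blast
next
  fix z' assume z': "z' \<in> carrier_vec n \<and> submatrix (Hmat G U) B B *\<^sub>v subvec z' B = subvec d B \<and>
    (\<forall>p<n. p \<notin> B \<longrightarrow> z' $ p = 0)"
  then have eq': "\<forall>p\<in>B. mv B Hf (($) z') p = d $ p" using sub_eq_iff[of z' d] d by blast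
  have ker: "mv B Hf (\<lambda>q. z' $ q + (-1) * z $ q) p = 0" if "p \<in> B" for p
    unfolding mv_add_scaled using eq eq' that by simp
  have "z' $ p = z $ p" if "p \<in> B" for p
    using basis_kernel[OF basis ker that] by simp
  then show "z' = z" using z z' out by (intro eq_vecI) (auto, metis)
qed

lemma basic_solution_props:
  assumes basis: "is_basis G U B" and d: "d \<in> carrier_vec n"
  shows "basic_solution G U B d \<in> carrier_vec n"
    and "p \<in> B \<Longrightarrow> mv B Hf (($) (basic_solution G U B d)) p = d $ p"
    and "p < n \<Longrightarrow> p \<notin> B \<Longrightarrow> basic_solution G U B d $ p = 0"
proof -
  obtain y where y: "\<And>p. p \<in> B \<Longrightarrow> mv B Hf y p = d $ p"
    using basis_solvable[OF basis, of "($) d"] by blast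
  define z where "z = vec n (\<lambda>p. if p \<in> B then y p else 0)"
  have "mv B Hf (($) z) p = mv B Hf y p" for p
    using B by (intro mv_cong) (auto simp: z_def)
  then have "basic_solution G U B d = z"
    using y by (intro basic_solution_eqI[OF basis d]) (auto simp: z_def)
  with \<open>\<And>p. mv B Hf (($) z) p = mv B Hf y p\<close> y show "basic_solution G U B d \<in> carrier_vec n"
    and "p \<in> B \<Longrightarrow> mv B Hf (($) (basic_solution G U B d)) p = d $ p"
    and "p < n \<Longrightarrow> p \<notin> B \<Longrightarrow> basic_solution G U B d $ p = 0"
    by (simp_all add: z_def)
qed

lemma basis_bounds:
  assumes basis: "is_basis G U B"
  defines "M \<equiv> submatrix (Hmat G U) B B"
  shows "(sigma_min M)\<^sup>2 * ip B v v \<le> ip B (mv B Hf v) (mv B Hf v)"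
    and "ip B (mv B Hf v) (mv B Hf v) \<le> (sigma_max M)\<^sup>2 * ip B v v"
    and "sigma_min M \<le> sigma_max M" and "0 < sigma_min M"
proof -
  have k: "0 < card B" using basis finite_B by (simp add: is_basis_def card_gt_0_iff)
  have op: "ip {..<card B} (mat_op M (\<lambda>l. v (pick B l))) (mat_op M (\<lambda>l. v (pick B l)))
      = ip B (mv B Hf v) (mv B Hf v)"
    unfolding ip_pick[symmetric] M_def by (intro ip_cong) (auto simp: sub_op)
  note bnd = singular_value_bounds[OF sub_carrier k, folded M_def]
  show "(sigma_min M)\<^sup>2 * ip B v v \<le> ip B (mv B Hf v) (mv B Hf v)"
    using bnd(1)[of "\<lambda>l. v (pick B l)"] unfolding op ip_pick .
  show "ip B (mv B Hf v) (mv B Hf v) \<le> (sigma_max M)\<^sup>2 * ip B v v"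
    using bnd(2)[of "\<lambda>l. v (pick B l)"] unfolding op ip_pick .
  show "sigma_min M \<le> sigma_max M" by (rule bnd(3))
  have "invertible_mat M" using basis by (simp add: is_basis_def M_def)
  then show "0 < sigma_min M"
    using invertible_mat_iff_mat_op(1)[OF sub_carrier] unfolding M_def[symmetric]
    by (intro bnd(4)) blast
qed

end

end

section \<open>Sensitivity\<close>

lemma L2_set_sum_le: "finite J \<Longrightarrow> L2_set (\<lambda>p. \<Sum>j\<in>J. f j p) A \<le> (\<Sum>j\<in>J. L2_set (f j) A)"
proof (induction J rule: finite_induct)
  case empty
  then show ?case by (simp add: L2_set_def)
next
  case (insert j J)
  have "L2_set (\<lambda>p. \<Sum>j\<in>insert j J. f j p) A = L2_set (\<lambda>p. f j p + (\<Sum>j\<in>J. f j p)) A"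
    using insert by simp
  also have "\<dots> \<le> L2_set (f j) A + L2_set (\<lambda>p. \<Sum>j\<in>J. f j p) A"
    by (rule L2_set_triangle_ineq)
  finally show ?case using insert by simp
qed

lemma mv_sum: "mv B H (\<lambda>q. \<Sum>j\<in>J. f j q) p = (\<Sum>j\<in>J. mv B H (f j) p)"
  unfolding mv_def sum_distrib_left by (rule sum.swap)

lemma closed_Collect_ball:
  "(\<And>p. p \<in> A \<Longrightarrow> closed {x. P p x}) \<Longrightarrow> closed {x. \<forall>p\<in>A. P p x}"
proof -
  assume "\<And>p. p \<in> A \<Longrightarrow> closed {x. P p x}"
  then have "closed (\<Inter>p\<in>A. {x. P p x})" by (intro closed_INT) blast
  also have "(\<Inter>p\<in>A. {x. P p x}) = {x. \<forall>p\<in>A. P p x}" by auto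
  finally show ?thesis .
qed

lemma mv_combination: "mv B H (\<lambda>q. c * u q + c' * v q) p = c * mv B H u p + c' * mv B H v p"
  by (simp add: mv_def sum.distrib sum_distrib_left algebra_simps)

text \<open>All KKT conditions are equations or weak inequalities between continuous functions of
  \<open>s\<close>; complementarity is quadratic in \<open>s\<close>, the others are affine.\<close>

lemma (in kkt_system) closed_kkt_segment:
  "closed {s::real. kkt (\<lambda>p. (1 - s) * d p + s * d' p) (\<lambda>p. (1 - s) * z p + s * z' p)}"
  unfolding kkt_def mv_combination
  by (intro closed_Collect_conj closed_Collect_ball closed_Collect_eq closed_Collect_le
      continuous_intros)

section \<open>Decay between node blocks for a fixed basis\<close>

context graph_problem
begin

text \<open>The flat indices of the block of node \<open>i\<close> itself, not of its neighbours in
  the graph.\<close>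

definition Nb :: "int \<Rightarrow> nat set" where
  "Nb i = {st i..<st i + ndim G i}"

lemma Nb_sub: "i \<in> U \<Longrightarrow> Nb i \<subseteq> {..<n}"
  using block_start_add_le_total[OF finU, of i "ndim G"] by (auto simp: Nb_def)

lemma node_Nb: "i \<in> U \<Longrightarrow> p \<in> Nb i \<Longrightarrow> block_node U (ndim G) p = i"
  using block_node_index[OF finU, of i "p - st i" "ndim G"] by (auto simp: Nb_def)

lemma Nb_node: "p < n \<Longrightarrow> p \<in> Nb (block_node U (ndim G) p)"
  using block_node_pos[OF finU, of p "ndim G"] by (auto simp: Nb_def)

lemma euclid_norm_Tblk: "euclid_norm (Tblk G U i v) = L2_set (($) v) (Nb i)"
proof -
  have "Tblk G U i v \<bullet> Tblk G U i v = (\<Sum>k<ndim G i. (v $ (st i + k))\<^sup>2)"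
    by (simp add: scalar_prod_def Tblk_index power2_eq_square atLeast0LessThan)
  also have "\<dots> = (\<Sum>p\<in>Nb i. (v $ p)\<^sup>2)"
    unfolding Nb_def
    using sum.shift_bounds_nat_ivl[of "\<lambda>p. (v $ p)\<^sup>2" 0 "st i" "ndim G i"]
    by (simp add: atLeast0LessThan add.commute)
  finally show ?thesis by (simp add: euclid_norm_def L2_set_def)
qed

lemma Hf_adj:
  assumes "p < n" "q < n" "Hf p q \<noteq> 0"
  defines "i \<equiv> block_node U (ndim G) p" and "j \<equiv> block_node U (ndim G) q"
  shows "i = j \<or> (i, j) \<in> induced_adj G U"
proof -
  note p = block_node_pos[OF finU assms(1), folded i_def]
  note q = block_node_pos[OF finU assms(2), folded j_def]
  have "Hf p q = Hblk G i j $$ (block_pos U (ndim G) p, block_pos U (ndim G) q)"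
    using Hf_index[OF p(1) q(1) p(2) q(2)] p(3) q(3) by simp
  then show ?thesis
    using assms(3) Hblk_zero[OF p(1) q(1) _ _ p(2) q(2)] p(1) q(1) by (auto simp: induced_adj_def)
qed

text \<open>Data perturbed at the single node \<open>j\<close>: a nonzero entry of the KKT matrix
  joins equal or adjacent nodes, so graph distance to \<open>j\<close> provides the growing sets for
  \<open>inverse_decay\<close>.\<close>

lemma block_decay:
  assumes B: "B \<subseteq> {..<n}" and ab: "0 < a" "a \<le> b"
    and lower: "\<And>v. a * ip B v v \<le> ip B (mv B Hf v) (mv B Hf v)"
    and upper: "\<And>v. ip B (mv B Hf v) (mv B Hf v) \<le> b * ip B v v"
    and y: "\<And>p. p \<in> B \<Longrightarrow> mv B Hf y p = (if p \<in> Nb j then e p else 0)"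
    and ij: "i \<in> U" "j \<in> U"
  shows "L2_set y (Nb i \<inter> B)
    \<le> dist_decay ((b - a) / (b + a)) (graph_dist G U i j) * (L2_set e (Nb j) / sqrt a)"
proof -
  let ?\<rho> = "(b - a) / (b + a)" and ?nd = "block_node U (ndim G)"
  let ?e = "\<lambda>p. if p \<in> Nb j then e p else 0"
  \<comment> \<open>Walks of length at most \<open>t\<close>, not exactly \<open>t\<close>: the sets
    must be increasing, and entries inside one node block make no progress in the graph.\<close>
  define S where "S t = {p. p < n \<and> (\<exists>m\<le>t. (?nd p, j) \<in> induced_adj G U ^^ m)}" for t
  have e: "L2_set ?e B \<le> L2_set e (Nb j)"
  proof -
    have "(\<Sum>p\<in>B. (?e p)\<^sup>2) = (\<Sum>p\<in>B \<inter> Nb j. (e p)\<^sup>2)"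
      using finite_B[OF B] by (intro sum.mono_neutral_cong_right) auto
    also have "\<dots> \<le> (\<Sum>p\<in>Nb j. (e p)\<^sup>2)"
      by (intro sum_mono2) (auto simp: Nb_def)
    finally show ?thesis by (simp add: L2_set_def)
  qed
  have bound: "L2_set y (Nb i \<inter> B) \<le> ?\<rho> ^ k * (L2_set e (Nb j) / sqrt a)"
    if far: "\<And>t m. k = Suc t \<Longrightarrow> (i, j) \<in> induced_adj G U ^^ m \<Longrightarrow> Suc (2 * t) < m" for k
  proof -
    have "L2_set y (Nb i \<inter> B) \<le> ?\<rho> ^ k * (L2_set ?e B / sqrt a)"
    proof (rule inverse_decay[where H = Hf and S = S])
      show "finite B" using B by (rule finite_B)
      show "\<forall>p\<in>B. \<forall>q\<in>B. Hf p q = Hf q p" using B Hf_sym by (auto simp: subset_iff)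
      show "?e p = 0" if "p \<in> B" "p \<notin> S 0" for p
        using that B node_Nb[OF ij(2)] by (auto simp: S_def)
      show "S t \<subseteq> S (Suc t)" for t by (auto simp: S_def intro: le_SucI)
      show "p \<in> S (Suc t)" if pq: "p \<in> B" "q \<in> B" "q \<in> S t" "Hf p q \<noteq> 0" for t p q
      proof -
        obtain m where m: "m \<le> t" "(?nd q, j) \<in> induced_adj G U ^^ m"
          using pq(3) by (auto simp: S_def)
        have "p < n" "q < n" using pq B by auto
        with Hf_adj[OF this pq(4)] consider "?nd p = ?nd q" | "(?nd p, ?nd q) \<in> induced_adj G U"
          by blast
        then show ?thesis
        proof cases
          case 1
          then show ?thesis using m \<open>p < n\<close> by (auto simp: S_def intro!: exI[of _ m])
        next
          case 2
          then have "(?nd p, j) \<in> induced_adj G U ^^ Suc m" using m(2) by (rule relpow_Suc_I2)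
          then show ?thesis using m \<open>p < n\<close> unfolding S_def by blast
        qed
      qed
      show "(Nb i \<inter> B) \<inter> S (Suc (2 * t)) = {}" if "k = Suc t" for t
      proof (rule ccontr)
        assume "\<not> ?thesis"
        then obtain p m where "p \<in> Nb i" "m \<le> Suc (2 * t)" "(?nd p, j) \<in> induced_adj G U ^^ m"
          by (auto simp: S_def)
        then show False using far[OF that, of m] node_Nb[OF ij(1), of p] by simp
      qed
    qed (use ab lower upper y in auto)
    also have "\<dots> \<le> ?\<rho> ^ k * (L2_set e (Nb j) / sqrt a)"
      using e ab by (intro mult_left_mono divide_right_mono) auto
    finally show ?thesis .
  qed
  show ?thesis
  proof (cases "graph_dist G U i j")
    case (enat k)
    have le: "k \<le> m" if "(i, j) \<in> induced_adj G U ^^ m" for m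
    proof -
      have "graph_dist G U i j \<le> enat m"
        unfolding graph_dist_def using that by (intro INF_lower) simp
      with enat show ?thesis by simp
    qed
    let ?k = "nat \<lceil>(real k - 1) / 2\<rceil>"
    \<comment> \<open>Exponent \<open>t + 1\<close> means \<open>t < (k - 1) / 2\<close>, hence
      \<open>2 t + 1 < k\<close>. As \<open>k\<close> is the distance, every walk from
      \<open>i\<close> to \<open>j\<close> is longer than \<open>2 t + 1\<close>.\<close>
    have "Suc (2 * t) < m" if "?k = Suc t" "(i, j) \<in> induced_adj G U ^^ m" for t m
    proof -
      have "real t < (real k - 1) / 2" using that(1) by linarith
      then have "real (Suc (2 * t)) < real k" by (simp add: field_simps)
      with le[OF that(2)] show ?thesis by (simp only: of_nat_less_iff)
    qed
    from bound[OF this] show ?thesis by (simp add: dist_decay_def enat)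
  next
    case infinity
    have none: "(i, j) \<notin> induced_adj G U ^^ m" for m
    proof
      assume "(i, j) \<in> induced_adj G U ^^ m"
      then have "graph_dist G U i j \<le> enat m"
        unfolding graph_dist_def by (intro INF_lower) simp
      with infinity show False by simp
    qed
    have \<rho>: "0 \<le> ?\<rho>" "?\<rho> < 1" using ab by (simp_all add: field_simps)
    \<comment> \<open>Without any walk the estimate holds for every exponent, and
      \<open>\<rho> < 1\<close> because \<open>a > 0\<close>; the limit gives the value 0 that
      \<open>dist_decay\<close> assigns to infinite distance.\<close>
    have "(\<lambda>k. ?\<rho> ^ k * (L2_set e (Nb j) / sqrt a)) \<longlonglongrightarrow> 0 * (L2_set e (Nb j) / sqrt a)"
      using \<rho> by (intro tendsto_mult tendsto_const LIMSEQ_realpow_zero)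
    then have "L2_set y (Nb i \<inter> B) \<le> 0 * (L2_set e (Nb j) / sqrt a)"
      by (rule LIMSEQ_le_const) (use bound none in blast)
    then show ?thesis by (simp add: dist_decay_def infinity)
  qed
qed

lemma optimal_bases_finite: "finite (optimal_bases G U D)"
proof (rule finite_subset)
  show "optimal_bases G U D \<subseteq> Pow {..<n}"
    by (auto simp: optimal_bases_def optimal_basis_def is_basis_def)
qed simp

text \<open>One pair of constants serves all bases met along the segment. Membership of
  \<open>B\<close> also makes the family nonempty, so that the minimum and maximum over it are
  genuine.\<close>

lemma sigma_bounds:
  assumes "B \<in> optimal_bases G U D"
  shows "0 < sigma_lower G U D" "sigma_lower G U D \<le> sigma_upper G U D"
    and "(sigma_lower G U D)\<^sup>2 * ip B v v \<le> ip B (mv B Hf v) (mv B Hf v)"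
    and "ip B (mv B Hf v) (mv B Hf v) \<le> (sigma_upper G U D)\<^sup>2 * ip B v v"
proof -
  let ?O = "optimal_bases G U D" and ?M = "\<lambda>B. submatrix (Hmat G U) B B"
  have basis: "B' \<subseteq> {..<n}" "is_basis G U B'" if "B' \<in> ?O" for B'
    using that by (auto simp: optimal_bases_def optimal_basis_def is_basis_def)
  note fin = optimal_bases_finite[of D]
  have lo: "sigma_lower G U D \<le> sigma_min (?M B)"
    unfolding sigma_lower_def using fin assms by (intro Min_le) auto
  have hi: "sigma_max (?M B) \<le> sigma_upper G U D"
    unfolding sigma_upper_def using fin assms by (intro Max_ge) auto
  show pos: "0 < sigma_lower G U D"
    unfolding sigma_lower_def using fin assms basis basis_bounds(4)
    by (subst Min_gr_iff) auto
  note bnd = basis_bounds[OF basis[OF assms]]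
  show "sigma_lower G U D \<le> sigma_upper G U D" using lo hi bnd(3) by linarith
  have "(sigma_lower G U D)\<^sup>2 * ip B v v \<le> (sigma_min (?M B))\<^sup>2 * ip B v v"
    using lo pos by (intro mult_right_mono power_mono ip_nonneg) auto
  with bnd(1)[of v] show "(sigma_lower G U D)\<^sup>2 * ip B v v \<le> ip B (mv B Hf v) (mv B Hf v)"
    by linarith
  have "(sigma_max (?M B))\<^sup>2 * ip B v v \<le> (sigma_upper G U D)\<^sup>2 * ip B v v"
    using hi bnd(3,4) by (intro mult_right_mono power_mono ip_nonneg) auto
  with bnd(2)[of v] show "ip B (mv B Hf v) (mv B Hf v) \<le> (sigma_upper G U D)\<^sup>2 * ip B v v"
    by linarith
qed

text \<open>By linearity the change of data is split into its node blocks; each piece is propagated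
  by \<open>block_decay\<close> and the responses are added.\<close>

lemma basic_solution_sensitivity:
  assumes B: "B \<in> optimal_bases G U D" and d: "d \<in> carrier_vec n" "d' \<in> carrier_vec n"
    and i: "i \<in> U"
  shows "L2_set (\<lambda>p. basic_solution G U B d $ p - basic_solution G U B d' $ p) (Nb i)
    \<le> (\<Sum>j\<in>U. Gamma_const G U D * dist_decay (rho_const G U D) (graph_dist G U i j)
          * L2_set (\<lambda>p. d $ p - d' $ p) (Nb j))"
proof -
  have basis: "B \<subseteq> {..<n}" "is_basis G U B"
    using B by (auto simp: optimal_bases_def optimal_basis_def is_basis_def)
  let ?z = "basic_solution G U B d" and ?z' = "basic_solution G U B d'"
  let ?lo = "sigma_lower G U D" and ?hi = "sigma_upper G U D"
  define y where "y = (\<lambda>p. ?z $ p + (-1) * ?z' $ p)"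
  define e where "e = (\<lambda>p. d $ p - d' $ p)"
  note sb = sigma_bounds[OF B]
  have y_B: "mv B Hf y p = e p" if "p \<in> B" for p
    unfolding y_def mv_add_scaled
    using basic_solution_props(2)[OF basis _ that] d by (simp add: e_def)
  \<comment> \<open>\<open>ys j\<close> is the response to the data change at node \<open>j\<close>
    alone. Each flat index lies in exactly one block, so the right-hand sides add up to
    \<open>e\<close>, and nonsingularity makes the responses add up to \<open>y\<close> on
    \<open>B\<close>.\<close>
  have "\<exists>y. \<forall>p\<in>B. mv B Hf y p = (if p \<in> Nb j then e p else 0)" for j
    by (rule basis_solvable[OF basis])
  then obtain ys where ys: "\<And>j p. p \<in> B \<Longrightarrow> mv B Hf (ys j) p = (if p \<in> Nb j then e p else 0)"
    by metis
  have y_sum: "y p = (\<Sum>j\<in>U. ys j p)" if "p \<in> B" for p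
  proof -
    have "mv B Hf (\<lambda>q. y q + (-1) * (\<Sum>j\<in>U. ys j q)) p = 0" if p: "p \<in> B" for p
    proof -
      have pn: "p < n" using p basis by auto
      have mem: "p \<in> Nb j \<longleftrightarrow> j = block_node U (ndim G) p" if "j \<in> U" for j
        using node_Nb[OF that, of p] Nb_node[OF pn] by metis
      have "(\<Sum>j\<in>U. mv B Hf (ys j) p) = (\<Sum>j\<in>U. if j = block_node U (ndim G) p then e p else 0)"
        by (intro sum.cong refl) (simp add: ys[OF p] mem)
      also have "\<dots> = e p" using finU block_node_pos(1)[OF finU pn] by simp
      finally show ?thesis unfolding mv_add_scaled mv_sum y_B[OF p] by simp
    qed
    from basis_kernel[OF basis this that] show ?thesis by simp
  qed
  have "L2_set y (Nb i) = L2_set y (Nb i \<inter> B)"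
  proof -
    have "y p = 0" if "p \<in> Nb i - B" for p
      using that Nb_sub[OF i] basic_solution_props(3)[OF basis] d by (auto simp: y_def)
    then have "(\<Sum>p\<in>Nb i. (y p)\<^sup>2) = (\<Sum>p\<in>Nb i \<inter> B. (y p)\<^sup>2)"
      by (intro sum.mono_neutral_right) (auto simp: Nb_def)
    then show ?thesis by (simp add: L2_set_def)
  qed
  also have "\<dots> = L2_set (\<lambda>p. \<Sum>j\<in>U. ys j p) (Nb i \<inter> B)"
    using y_sum by (intro L2_set_cong) auto
  also have "\<dots> \<le> (\<Sum>j\<in>U. L2_set (ys j) (Nb i \<inter> B))"
    using finU by (rule L2_set_sum_le)
  also have "\<dots> \<le> (\<Sum>j\<in>U. Gamma_const G U D * dist_decay (rho_const G U D) (graph_dist G U i j)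
          * L2_set e (Nb j))"
  proof (rule sum_mono)
    fix j assume j: "j \<in> U"
    let ?\<Delta> = "dist_decay (rho_const G U D) (graph_dist G U i j)"
    have sq: "0 < ?lo\<^sup>2" "?lo\<^sup>2 \<le> ?hi\<^sup>2"
      using sb(1,2) by (simp_all add: power_mono)
    have \<rho>: "0 \<le> rho_const G U D" using sq by (simp add: rho_const_def)
    then have \<Delta>: "0 \<le> ?\<Delta>" by (simp add: dist_decay_def split: enat.split)
    have "L2_set (ys j) (Nb i \<inter> B) \<le> ?\<Delta> * (L2_set e (Nb j) / sqrt (?lo\<^sup>2))"
      unfolding rho_const_def
      by (rule block_decay[OF basis(1) sq sb(3) sb(4) ys i j])
    also have "\<dots> = ?\<Delta> * L2_set e (Nb j) * (1 / ?lo)"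
      using sb(1) by simp
    \<comment> \<open>\<open>1 / lo = lo / lo^2 <= hi / lo^2\<close>.\<close>
    also have "1 / ?lo \<le> Gamma_const G U D"
      using sb(1,2) by (simp add: Gamma_const_def field_simps power2_eq_square)
    then have "?\<Delta> * L2_set e (Nb j) * (1 / ?lo) \<le> ?\<Delta> * L2_set e (Nb j) * Gamma_const G U D"
      using \<Delta> by (intro mult_left_mono) auto
    finally show "L2_set (ys j) (Nb i \<inter> B) \<le> Gamma_const G U D * ?\<Delta> * L2_set e (Nb j)"
      by (simp add: mult_ac)
  qed
  finally show ?thesis by (simp add: y_def e_def)
qed

end

section \<open>Passage from a single basis to the whole data segment\<close>

locale regular_graph_problem = graph_problem +
  fixes D :: "real vec set"
  assumes D: "D \<subseteq> carrier_vec n" and convex: "convex_vecs D"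
    and psd: "pos_semidef (Qmat G U)"
    and regular: "\<forall>d\<in>D. \<exists>z. primal_dual_solution G U d z \<and> SOSC G U d z \<and> LICQ G U d z"
begin

lemma zstar_eq:
  assumes "d \<in> D" "primal_dual_solution G U d z'"
  shows "zstar G U d = z'"
proof -
  obtain z where z: "primal_dual_solution G U d z" "SOSC G U d z" "LICQ G U d z"
    using regular assms(1) by blast
  have unique: "u = z" if "primal_dual_solution G U d u" for u
  proof (rule eq_vecI)
    show "dim_vec u = dim_vec z" using that z(1) by (auto simp: primal_dual_solution_iff_kkt)
    fix p assume "p < dim_vec z"
    then have "p < n" using z(1) by (auto simp: primal_dual_solution_iff_kkt)
    then show "u $ p = z $ p"
      using kkt_unique[OF pos_semidef_imp[OF psd], of "($) d" "($) z" "($) u" p] z that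
        SOSC_imp_sosc[OF z(2)] LICQ_imp_licq[OF z(3)] partition
      by (auto simp: primal_dual_solution_iff_kkt)
  qed
  then show ?thesis
    unfolding zstar_def using assms(2) by (intro the_equality) auto
qed

lemma optimal_basis_exists:
  assumes "d \<in> D"
  obtains B where "optimal_basis G U d B"
proof -
  obtain z where z: "primal_dual_solution G U d z" "SOSC G U d z" "LICQ G U d z"
    using regular assms by blast
  have zn: "z \<in> carrier_vec n" and kkt: "kkt (($) d) (($) z)"
    using z(1) by (auto simp: primal_dual_solution_iff_kkt)
  define B where "B = active_basis (($) d) (($) z)"
  have B: "B \<subseteq> {..<n}"
    using partition unfolding B_def active_basis_def by auto
  \<comment> \<open>A basis has to be nonempty: some node exists and carries at least one primal
    variable.\<close>
  obtain i where i: "i \<in> U" using neU by blast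
  then have "1 \<le> rdim G i" using valid sub by (auto simp: valid_graph_qp_def)
  then have "st i + 0 \<in> XI"
    unfolding XI_def using i by (subst index_in_seg[OF finU]) (auto simp: ndim_def)
  then have "B \<noteq> {}" by (auto simp: B_def active_basis_def)
  moreover have "v p = 0" if "\<forall>p\<in>B. mv B Hf v p = 0" "p \<in> B" for v p
    using active_basis_nonsingular[OF SOSC_imp_sosc[OF z(2)] LICQ_imp_licq[OF z(3)], of v p] that
    by (simp add: B_def)
  ultimately have basis: "is_basis G U B" unfolding is_basis_iff[OF B] by blast
  have "basic_solution G U B d = z"
  proof (rule basic_solution_eqI[OF B basis _ zn])
    show "d \<in> carrier_vec n" using D assms by auto
    show "mv B Hf (($) z) p = d $ p" if "p \<in> B" for p
      using active_basis_solution(2)[OF kkt] that by (simp add: B_def)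
    show "z $ p = 0" if "p < n" "p \<notin> B" for p
      using active_basis_solution(1)[OF kkt, of p] that partition by (simp add: B_def)
  qed
  then have "optimal_basis G U d B" using basis z(1) by (simp add: optimal_basis_def)
  then show thesis by (rule that)
qed

text \<open>For a fixed basis the basic solution is affine in the data, so along the segment
  optimality is the closed condition of \<open>closed_kkt_segment\<close>. If \<open>B\<close> is no
  basis the set is empty.\<close>

lemma closed_optimal_parameters:
  assumes d: "d \<in> D" "d' \<in> D"
  shows "closed {s \<in> {0..1}. optimal_basis G U ((1 - s) \<cdot>\<^sub>v d + s \<cdot>\<^sub>v d') B}"
proof (cases "is_basis G U B")
  case False
  then show ?thesis by (simp add: optimal_basis_def)
next
  case True
  then have B: "B \<subseteq> {..<n}" by (auto simp: is_basis_def)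
  have dn: "d \<in> carrier_vec n" "d' \<in> carrier_vec n" using d D by auto
  let ?z = "basic_solution G U B d" and ?z' = "basic_solution G U B d'"
  note b = basic_solution_props[OF B True dn(1)] and b' = basic_solution_props[OF B True dn(2)]
  have basic: "basic_solution G U B ((1 - s) \<cdot>\<^sub>v d + s \<cdot>\<^sub>v d') = (1 - s) \<cdot>\<^sub>v ?z + s \<cdot>\<^sub>v ?z'" for s
  proof (rule basic_solution_eqI[OF B True])
    fix p assume p: "p \<in> B"
    then have pn: "p < n" using B by auto
    have "mv B Hf (($) ((1 - s) \<cdot>\<^sub>v ?z + s \<cdot>\<^sub>v ?z')) p
        = mv B Hf (\<lambda>q. (1 - s) * ?z $ q + s * ?z' $ q) p"
      using b(1) b'(1) B by (intro mv_cong) auto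
    then show "mv B Hf (($) ((1 - s) \<cdot>\<^sub>v ?z + s \<cdot>\<^sub>v ?z')) p = ((1 - s) \<cdot>\<^sub>v d + s \<cdot>\<^sub>v d') $ p"
      using b(2) b'(2) p pn dn by (simp add: mv_combination)
  qed (use dn b b' in auto)
  \<comment> \<open>Entries of a vector at indices from \<open>n\<close> on are unspecified, so the
    two sides match only below \<open>n\<close>, which is all that \<open>kkt\<close>
    inspects.\<close>
  have cong: "kkt e z = kkt e' z'"
    if "\<And>p. p < n \<Longrightarrow> e p = e' p" "\<And>p. p < n \<Longrightarrow> z p = z' p" for e e' z z'
  proof -
    have "mv XI Hf z p = mv XI Hf z' p" "mv (EI \<union> II) Hf z p = mv (EI \<union> II) Hf z' p" for p
      using that partition by (auto intro!: mv_cong)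
    moreover have "\<And>p. p \<in> XI \<union> EI \<union> II \<Longrightarrow> e p = e' p" "\<And>p. p \<in> XI \<union> EI \<union> II \<Longrightarrow> z p = z' p"
      using that unfolding partition by auto
    ultimately show ?thesis unfolding kkt_def by auto
  qed
  have "kkt (($) ((1 - s) \<cdot>\<^sub>v d + s \<cdot>\<^sub>v d')) (($) ((1 - s) \<cdot>\<^sub>v ?z + s \<cdot>\<^sub>v ?z')) \<longleftrightarrow>
    kkt (\<lambda>p. (1 - s) * d $ p + s * d' $ p) (\<lambda>p. (1 - s) * ?z $ p + s * ?z' $ p)" for s
    using b(1) b'(1) dn by (intro cong) auto
  then have "optimal_basis G U ((1 - s) \<cdot>\<^sub>v d + s \<cdot>\<^sub>v d') B \<longleftrightarrow>
    kkt (\<lambda>p. (1 - s) * d $ p + s * d' $ p) (\<lambda>p. (1 - s) * ?z $ p + s * ?z' $ p)" for s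
    unfolding optimal_basis_def primal_dual_solution_iff_kkt basic using True b(1) b'(1) by simp
  then have "{s \<in> {0..1}. optimal_basis G U ((1 - s) \<cdot>\<^sub>v d + s \<cdot>\<^sub>v d') B} = {0..1} \<inter>
    {s. kkt (\<lambda>p. (1 - s) * d $ p + s * d' $ p) (\<lambda>p. (1 - s) * ?z $ p + s * ?z' $ p)}"
    by auto
  then show ?thesis using closed_kkt_segment by (simp add: closed_Int)
qed

text \<open>The claimed bound \<open>L\<close> is read as a speed limit for block \<open>i\<close>
  while the data travel from \<open>d\<close> to \<open>d'\<close> in unit time; within one basis it
  is the single-basis estimate.\<close>

lemma sensitivity:
  assumes d: "d \<in> D" "d' \<in> D" and i: "i \<in> U"
  shows "euclid_norm (Tblk G U i (zstar G U d - zstar G U d'))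
    \<le> (\<Sum>j\<in>U. Gamma_const G U D * dist_decay (rho_const G U D) (graph_dist G U i j)
          * euclid_norm (Tblk G U j d - Tblk G U j d'))"
proof -
  have dn: "d \<in> carrier_vec n" "d' \<in> carrier_vec n" using d D by auto
  define ds where "ds s = (1 - s) \<cdot>\<^sub>v d + s \<cdot>\<^sub>v d'" for s
  define c where "c j = Gamma_const G U D * dist_decay (rho_const G U D) (graph_dist G U i j)" for j
  define L where "L = (\<Sum>j\<in>U. c j * L2_set (\<lambda>p. d $ p - d' $ p) (Nb j))"
  define \<delta> where "\<delta> s t = L2_set (\<lambda>p. zstar G U (ds s) $ p - zstar G U (ds t) $ p) (Nb i)" for s t
  define S where "S B = {s \<in> {0..1}. optimal_basis G U (ds s) B}" for B
  have ds: "ds s \<in> D" "ds s \<in> carrier_vec n" if "s \<in> {0..1}" for s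
    using that convex d D by (auto simp: convex_vecs_def ds_def)
  have zstar: "zstar G U (ds s) = basic_solution G U B (ds s)" if "s \<in> S B" for s B
    using that ds by (intro zstar_eq) (auto simp: S_def optimal_basis_def)
  have "\<delta> 0 1 \<le> L * (1 - 0)"
  proof (rule piecewise_lipschitz[where F = "optimal_bases G U D" and S = S])
    show "\<delta> r t \<le> \<delta> r s + \<delta> s t" for r s t
      unfolding \<delta>_def
      using L2_set_triangle_ineq[of "\<lambda>p. zstar G U (ds r) $ p - zstar G U (ds s) $ p"
          "\<lambda>p. zstar G U (ds s) $ p - zstar G U (ds t) $ p" "Nb i"] by simp
    show "closed (S B)" for B
      unfolding S_def ds_def using d by (rule closed_optimal_parameters)
    \<comment> \<open>Convexity keeps the whole segment in \<open>D\<close>, so every basis met on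
      the way belongs to the family over which the sigma constants are taken.\<close>
    show "{0..1} \<subseteq> (\<Union>B\<in>optimal_bases G U D. S B)"
    proof
      fix s :: real assume s: "s \<in> {0..1}"
      obtain B where "optimal_basis G U (ds s) B" using optimal_basis_exists[OF ds(1)[OF s]] .
      then show "s \<in> (\<Union>B\<in>optimal_bases G U D. S B)"
        using ds(1)[OF s] s by (auto simp: S_def optimal_bases_def)
    qed
    show "\<delta> s t \<le> L * (t - s)"
      if B: "B \<in> optimal_bases G U D" and st: "s \<in> S B" "t \<in> S B" "s \<le> t" for B s t
    proof -
      have carr: "ds s \<in> carrier_vec n" "ds t \<in> carrier_vec n"
        using st ds by (auto simp: S_def)
      \<comment> \<open>Each block of the data moves at constant speed, which makes the single-basis
        bound proportional to \<open>t - s\<close>.\<close>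
      have diff: "L2_set (\<lambda>p. ds s $ p - ds t $ p) (Nb j)
          = (t - s) * L2_set (\<lambda>p. d $ p - d' $ p) (Nb j)" if "j \<in> U" for j
      proof -
        have "L2_set (\<lambda>p. ds s $ p - ds t $ p) (Nb j)
            = L2_set (\<lambda>p. (t - s) * (d $ p - d' $ p)) (Nb j)"
          using Nb_sub[OF that] dn
          by (intro L2_set_cong) (auto simp: ds_def algebra_simps subset_iff)
        also have "\<dots> = (t - s) * L2_set (\<lambda>p. d $ p - d' $ p) (Nb j)"
          using st(3) by (simp add: L2_set_right_distrib)
        finally show ?thesis .
      qed
      have "\<delta> s t \<le> (\<Sum>j\<in>U. c j * L2_set (\<lambda>p. ds s $ p - ds t $ p) (Nb j))"
        unfolding \<delta>_def zstar[OF st(1)] zstar[OF st(2)] c_def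
        using B carr i by (rule basic_solution_sensitivity)
      also have "\<dots> = L * (t - s)"
        unfolding L_def sum_distrib_right by (intro sum.cong) (auto simp: diff)
      finally show ?thesis .
    qed
  qed (auto simp: optimal_bases_finite)
  moreover have "ds 0 = d" "ds 1 = d'" using dn by (auto simp: ds_def)
  moreover have zn: "zstar G U u \<in> carrier_vec n" if "u \<in> D" for u
  proof -
    obtain z where "primal_dual_solution G U u z" using regular \<open>u \<in> D\<close> by blast
    with zstar_eq[OF \<open>u \<in> D\<close> this] show ?thesis by (simp add: primal_dual_solution_iff_kkt)
  qed
  have "euclid_norm (Tblk G U i (zstar G U d - zstar G U d'))
      = L2_set (\<lambda>p. zstar G U d $ p - zstar G U d' $ p) (Nb i)"
    unfolding euclid_norm_Tblk using zn[OF d(1)] zn[OF d(2)] Nb_sub[OF i]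
    by (intro L2_set_cong) (auto simp: subset_iff)
  moreover have "euclid_norm (Tblk G U j d - Tblk G U j d') = L2_set (\<lambda>p. d $ p - d' $ p) (Nb j)"
    if "j \<in> U" for j
  proof -
    have "Tblk G U j d - Tblk G U j d' = Tblk G U j (d - d')"
      using dn block_index_less[OF finU that] by (auto simp: Tblk_def extract_block_def)
    then show ?thesis
      unfolding euclid_norm_Tblk using dn Nb_sub[OF that]
      by (auto simp: euclid_norm_Tblk subset_iff intro!: L2_set_cong)
  qed
  ultimately show ?thesis by (simp add: \<delta>_def L_def c_def)
qed

end

theorem theorem1:
  fixes G :: graph_qp and U :: "int set" and D :: "real vec set"
  assumes "valid_graph_qp G"
    and "U \<subseteq> nodes G" and "finite U" and "U \<noteq> {}"
    and "D \<subseteq> carrier_vec (nU G U)" and "convex_vecs D"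
    and "pos_semidef (Qmat G U)"
    and "\<forall>d\<in>D. \<exists>z. primal_dual_solution G U d z \<and> SOSC G U d z \<and> LICQ G U d z"
  shows "\<forall>d\<in>D. \<forall>d'\<in>D. \<forall>i\<in>U.
    euclid_norm (Tblk G U i (zstar G U d - zstar G U d'))
      \<le> (\<Sum>j\<in>U. Gamma_const G U D * dist_decay (rho_const G U D) (graph_dist G U i j)
            * euclid_norm (Tblk G U j d - Tblk G U j d'))"
proof -
  interpret regular_graph_problem G U D
    using assms by unfold_locales auto
  show ?thesis using sensitivity by blast
qed

end
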